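(* Let $n=p_1^{n_1}p_2^{n_2}\cdots p_r^{n_r}$, where $p_1<p_2<\cdots<p_r$ are primes and $n_1,\ldots,n_r$ are positive integers. Assume $r\geq 4$, $n_r\geq 2$ and $2\phi(p_1p_2\cdots p_{r-1})<p_1p_2\cdots p_{r-1}$, and let $X$ be a minimum cut-set of the power graph $\mathcal{P}(C_n)$. Define $$\Omega:=\left\{j\in [r-1]\;\middle|\; n_j\geq 3,\; p_r-p_j\leq r-4,\; 2\phi\left(\frac{p_1p_2\cdots p_r}{p_j}\right)<\frac{p_1p_2\cdots p_r}{p_j}\right\}.$$ Then: (i) If $n_r\geq 3$ or $\Omega=\emptyset$, then $X=Z_r^{n_r}$ and hence $\kappa(\mathcal{P}(C_n))=\beta_r^{n_r}$. (ii) If $n_r=2$ and $\Omega\neq\emptyset$, then $X=Z_r^{n_r}$ or $X=Z_b^{n_b}$, where $b$ is the largest element of $\Omega$; consequently $\kappa(\mathcal{P}(C_n))\in\{\beta_b^{n_b},\beta_r^{n_r}\}$.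
   Context: $[m]=\{1,\dots,m\}$, $\phi$ is Euler's totient function, $C_n$ is the cyclic group of order $n$. The power graph $\mathcal{P}(C_n)$ has vertex set $C_n$, two distinct vertices adjacent iff one is a power of the other. A cut-set of a graph is a vertex subset whose removal leaves a disconnected induced subgraph; a minimum cut-set is one of least size; $\kappa$ denotes vertex connectivity (equal to the size of a minimum cut-set for non-complete graphs). For a divisor $d$ of $n$, $E_d$ is the set of elements of $C_n$ of order $d$ and $S_d$ the set of elements of order dividing $d$ (the subgroup of order $d$). For $a\in[r]$ and $s\in[n_a]$, let $Q_a^s=\bigcup_{i\in[r]\setminus\{a\}} S_{n/(p_ip_a^s)}$ and $Z_a^s:=E_n\cup E_{n/p_a}\cup E_{n/p_a^2}\cup\cdots\cup E_{n/p_a^{s-1}}\cup Q_a^s$, and $$\beta_a^s:=\phi(n)+\frac{n}{p_1\cdots p_r}\cdot\frac{1}{p_a^{s-1}}\left[\frac{p_1\cdots p_r}{p_a}+\phi\left(\frac{p_1\cdots p_r}{p_a}\right)(p_a^{s-1}-2)\right].$$ *)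

theory Defs
  imports
    "HOL-Number_Theory.Totient"
    "HOL-Algebra.Multiplicative_Group"
    "HOL-Algebra.Elementary_Groups"
    "Graph_Theory.Digraph_Component"
begin

(* An undirected graph is a symmetric digraph, as is usual in Graph_Theory. *)
definition power_graph :: "('a, 'c) monoid_scheme \<Rightarrow> ('a, 'a \<times> 'a) pre_digraph" where
  "power_graph G =
     \<lparr> verts = carrier G,
       arcs = {(x, y). x \<in> carrier G \<and> y \<in> carrier G \<and> x \<noteq> y \<and>
                 (\<exists>k::nat. y = x [^]\<^bsub>G\<^esub> k \<or> x = y [^]\<^bsub>G\<^esub> k)},
       tail = fst,
       head = snd \<rparr>"

definition remove_verts :: "('a, 'b) pre_digraph \<Rightarrow> 'a set \<Rightarrow> ('a, 'b) pre_digraph" where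
  "remove_verts \<Gamma> X = induce_subgraph \<Gamma> (verts \<Gamma> - X)"

(* The library's notion of connectedness excludes the graph without vertices. That graph is not
   regarded as disconnected here, so the set of all vertices is not a cut-set. *)
definition cut_set :: "('a, 'b) pre_digraph \<Rightarrow> 'a set \<Rightarrow> bool" where
  "cut_set \<Gamma> X \<longleftrightarrow> X \<subset> verts \<Gamma> \<and> \<not> Digraph_Component.connected (remove_verts \<Gamma> X)"

definition min_cut_set :: "('a, 'b) pre_digraph \<Rightarrow> 'a set \<Rightarrow> bool" where
  "min_cut_set \<Gamma> X \<longleftrightarrow> cut_set \<Gamma> X \<and> (\<forall>Y. cut_set \<Gamma> Y \<longrightarrow> card X \<le> card Y)"

(* The least number of vertices whose removal leaves a disconnected graph or a single vertex;
   intended for finite graphs with at least one vertex. The second alternative only matters for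
   complete graphs: a graph on m vertices that is not complete has a cut-set of size at most m - 2. *)
definition vertex_connectivity :: "('a, 'b) pre_digraph \<Rightarrow> nat" where
  "vertex_connectivity \<Gamma> =
     (LEAST k. \<exists>X. X \<subseteq> verts \<Gamma> \<and> card X = k \<and>
        (cut_set \<Gamma> X \<or> card (verts (remove_verts \<Gamma> X)) = 1))"

definition elems_of_order :: "('a, 'c) monoid_scheme \<Rightarrow> nat \<Rightarrow> 'a set" where
  "elems_of_order G d = {x \<in> carrier G. group.ord G x = d}"

definition elems_of_order_dvd :: "('a, 'c) monoid_scheme \<Rightarrow> nat \<Rightarrow> 'a set" where
  "elems_of_order_dvd G d = {x \<in> carrier G. group.ord G x dvd d}"

(* Below, the primes are p 1, ..., p r, and the exponents are e 1, ..., e r. All divisions of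
   natural numbers are exact when n is the product of the p i ^ e i, 1 \<le> a \<le> r and 1 \<le> s \<le> e a. *)

definition Qset ::
  "('a, 'c) monoid_scheme \<Rightarrow> nat \<Rightarrow> nat \<Rightarrow> (nat \<Rightarrow> nat) \<Rightarrow> nat \<Rightarrow> nat \<Rightarrow> 'a set" where
  "Qset G n r p a s = (\<Union>i \<in> {1..r} - {a}. elems_of_order_dvd G (n div (p i * p a ^ s)))"

definition Zset ::
  "('a, 'c) monoid_scheme \<Rightarrow> nat \<Rightarrow> nat \<Rightarrow> (nat \<Rightarrow> nat) \<Rightarrow> nat \<Rightarrow> nat \<Rightarrow> 'a set" where
  "Zset G n r p a s = (\<Union>j \<in> {0..<s}. elems_of_order G (n div p a ^ j)) \<union> Qset G n r p a s"

(* Real-valued because p a ^ (s - 1) - 2 is negative for s = 1. *)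
definition beta :: "nat \<Rightarrow> nat \<Rightarrow> (nat \<Rightarrow> nat) \<Rightarrow> nat \<Rightarrow> nat \<Rightarrow> real" where
  "beta n r p a s =
     real (totient n) +
     real n / real (\<Prod>i=1..r. p i) * (1 / real (p a ^ (s - 1))) *
       (real (\<Prod>i=1..r. p i) / real (p a) +
        real (totient ((\<Prod>i=1..r. p i) div p a)) * (real (p a ^ (s - 1)) - 2))"

definition Omega :: "nat \<Rightarrow> (nat \<Rightarrow> nat) \<Rightarrow> (nat \<Rightarrow> nat) \<Rightarrow> nat set" where
  "Omega r p e =
     {j \<in> {1..r - 1}. e j \<ge> 3 \<and> int (p r) - int (p j) \<le> int r - 4 \<and>
        2 * totient ((\<Prod>i=1..r. p i) div p j) < (\<Prod>i=1..r. p i) div p j}"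

end

theory Submission
  imports Defs
begin

text \<open>
  In a cyclic group of order \<open>n\<close> two elements are adjacent in the power graph iff their orders are
  comparable under divisibility. If \<open>X\<close> is a minimum cut-set and \<open>A\<close>, \<open>B\<close> separate its complement,
  then \<open>X\<close> consists of the elements below both \<open>A\<close> and \<open>B\<close> and the elements above both. The
  sets of elements below \<open>A\<close> and below \<open>B\<close> are positively correlated (Harris' inequality on the
  divisor lattice, a product of chains); since \<open>|X| < n / 2\<close>, this forces \<open>X\<close> to have at least as
  many elements as there are above one of the sides, say \<open>A\<close>. If each of two different
  \<open>n / p\<^sub>i\<close>, \<open>n / p\<^sub>j\<close> were a multiple of some order in \<open>A\<close>, there would be at least \<open>\<phi>(n) + \<phi>(n / p\<^sub>i) + \<phi>(n / p\<^sub>j)\<close> of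
  these, which exceeds \<open>|Z\<^sub>r\<^sup>s|\<close> for \<open>s = n\<^sub>r\<close>. So all orders in \<open>A\<close> are of the form
  \<open>n / p\<^sub>i\<^sup>t\<close> for one \<open>i\<close>, hence \<open>X = Z\<^sub>i\<^sup>s\<close>. It remains to compare the sizes of the sets
  \<open>Z\<^sub>i\<^sup>s\<close>: writing \<open>\<psi>\<^sub>i\<close> for the product of \<open>1 - 1 / p\<^sub>k\<close> over \<open>k \<noteq> i\<close>, the size of
  \<open>Z\<^sub>i\<^sup>s\<close> is \<open>n (\<psi>\<^sub>i + (1 - 2 \<psi>\<^sub>i) / p\<^sub>i\<^sup>s)\<close>.
\<close>

section \<open>Correlation of downward closed sets of divisors\<close>

lemma sum_divisors_coprime_mult:
  fixes a b :: nat
  assumes ab: "coprime a b"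
  shows "(\<Sum>d | d dvd a * b. h d) = (\<Sum>x | x dvd a. \<Sum>y | y dvd b. h (x * y))"
proof -
  have gcd_a: "gcd (x * y) a = x" and gcd_b: "gcd (x * y) b = y" if "x dvd a" "y dvd b" for x y
  proof -
    have "coprime a y" "coprime b x"
      using ab that coprime_divisors[of a a y b] coprime_divisors[of x a b b]
      by (auto simp: coprime_commute)
    then show "gcd (x * y) a = x" "gcd (x * y) b = y"
      using that by (simp_all add: gcd_mult_left_right_cancel gcd_mult_left_left_cancel
        gcd_proj1_iff)
  qed
  have "(\<Sum>d | d dvd a * b. h d) = (\<Sum>(x, y) \<in> {x. x dvd a} \<times> {y. y dvd b}. h (x * y))"
  proof (rule sum.reindex_bij_witness[of _ "\<lambda>(x, y). x * y" "\<lambda>d. (gcd d a, gcd d b)"])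
    fix d assume "d \<in> {d. d dvd a * b}"
    then obtain x y where "d = x * y" "x dvd a" "y dvd b"
      using division_decomp by blast
    then show "(case (gcd d a, gcd d b) of (x, y) \<Rightarrow> x * y) = d"
      and "(case (gcd d a, gcd d b) of (x, y) \<Rightarrow> h (x * y)) = h d"
      using gcd_a gcd_b by simp_all
  qed (auto simp: gcd_a gcd_b mult_dvd_mono)
  then show ?thesis
    by (simp add: sum.cartesian_product)
qed

definition positively_correlated :: "nat \<Rightarrow> bool" where
  "positively_correlated n \<longleftrightarrow>
     (\<forall>(f :: nat \<Rightarrow> real) (g :: nat \<Rightarrow> real).
        (\<forall>a b. a dvd b \<longrightarrow> b dvd n \<longrightarrow> f b \<le> f a \<and> g b \<le> g a) \<longrightarrow>
        (\<Sum>d | d dvd n. totient d * f d) * (\<Sum>d | d dvd n. totient d * g d)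
          \<le> n * (\<Sum>d | d dvd n. totient d * (f d * g d)))"

lemma positively_correlatedD:
  fixes f g :: "nat \<Rightarrow> real"
  assumes "positively_correlated n"
    and "\<And>a b. a dvd b \<Longrightarrow> b dvd n \<Longrightarrow> f b \<le> f a"
    and "\<And>a b. a dvd b \<Longrightarrow> b dvd n \<Longrightarrow> g b \<le> g a"
  shows "(\<Sum>d | d dvd n. totient d * f d) * (\<Sum>d | d dvd n. totient d * g d)
           \<le> n * (\<Sum>d | d dvd n. totient d * (f d * g d))"
  using assms unfolding positively_correlated_def by blast

lemma positively_correlated_coprime_mult:
  assumes "positively_correlated a" "positively_correlated b" "coprime a b"
  shows "positively_correlated (a * b)"
  unfolding positively_correlated_def
proof (intro allI impI)
  fix f g :: "nat \<Rightarrow> real"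
  assume fg: "\<forall>x y. x dvd y \<longrightarrow> y dvd a * b \<longrightarrow> f y \<le> f x \<and> g y \<le> g x"
  define avg where "avg k x = (\<Sum>y | y dvd b. totient y * (k (x * y)))" for k :: "nat \<Rightarrow> real" and x
  have tot: "totient (x * y) = totient x * totient y" if "x dvd a" "y dvd b" for x y
    using that coprime_divisors[OF _ _ assms(3)] by (simp add: totient_mult_coprime)
  have split: "(\<Sum>d | d dvd a * b. totient d * k d) = (\<Sum>x | x dvd a. totient x * avg k x)"
    for k :: "nat \<Rightarrow> real"
    unfolding sum_divisors_coprime_mult[OF assms(3)] avg_def sum_distrib_left
    by (intro sum.cong) (auto simp: tot)
  have avg_antimono: "avg k y \<le> avg k x"
    if "\<forall>x y. x dvd y \<longrightarrow> y dvd a * b \<longrightarrow> k y \<le> k x" "x dvd y" "y dvd a" for k x y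
    unfolding avg_def using that by (intro sum_mono mult_left_mono) (auto intro: mult_dvd_mono)
  have inner: "avg f x * avg g x \<le> b * avg (\<lambda>d. f d * g d) x" if "x dvd a" for x
    unfolding avg_def using fg that
    by (intro positively_correlatedD[OF assms(2)]) (auto intro: mult_dvd_mono)
  have "(\<Sum>d | d dvd a * b. totient d * f d) * (\<Sum>d | d dvd a * b. totient d * g d)
      = (\<Sum>x | x dvd a. totient x * avg f x) * (\<Sum>x | x dvd a. totient x * avg g x)"
    by (simp only: split)
  also have "\<dots> \<le> a * (\<Sum>x | x dvd a. totient x * (avg f x * avg g x))"
    using fg by (intro positively_correlatedD[OF assms(1)] avg_antimono) auto
  also have "\<dots> \<le> a * (\<Sum>x | x dvd a. totient x * (b * avg (\<lambda>d. f d * g d) x))"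
    using inner by (intro mult_left_mono sum_mono) auto
  also have "\<dots> = real (a * b) * (\<Sum>d | d dvd a * b. totient d * (f d * g d))"
    unfolding split by (simp add: sum_distrib_left mult_ac)
  finally show "(\<Sum>d | d dvd a * b. totient d * f d) * (\<Sum>d | d dvd a * b. totient d * g d)
      \<le> real (a * b) * (\<Sum>d | d dvd a * b. totient d * (f d * g d))" .
qed

text \<open>The divisors of a prime power form a chain, so this is Chebyshev's sum inequality.\<close>

lemma positively_correlated_prime_power:
  assumes "prime p"
  shows "positively_correlated (p ^ k)"
  unfolding positively_correlated_def
proof (intro allI impI)
  fix f g :: "nat \<Rightarrow> real"
  assume fg: "\<forall>a b. a dvd b \<longrightarrow> b dvd p ^ k \<longrightarrow> f b \<le> f a \<and> g b \<le> g a"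
  let ?D = "{d. d dvd p ^ k}" and ?w = "\<lambda>d. real (totient d)"
  have "p ^ k > 0"
    using assms prime_gt_0_nat by auto
  have chain: "a dvd b \<or> b dvd a" if "a dvd p ^ k" "b dvd p ^ k" for a b
    using that assms by (metis divides_primepow_nat le_imp_power_dvd nat_le_linear)
  have "0 \<le> (\<Sum>a\<in>?D. \<Sum>b\<in>?D. ?w a * ?w b * ((f a - f b) * (g a - g b)))"
  proof (intro sum_nonneg)
    fix a b assume "a \<in> ?D" "b \<in> ?D"
    then consider "f b \<le> f a \<and> g b \<le> g a" | "f a \<le> f b \<and> g a \<le> g b"
      using chain fg by blast
    then have "0 \<le> (f a - f b) * (g a - g b)"
      by cases (auto intro: mult_nonneg_nonneg mult_nonpos_nonpos)
    then show "0 \<le> ?w a * ?w b * ((f a - f b) * (g a - g b))"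
      by simp
  qed
  also have "\<dots> = (\<Sum>a\<in>?D. \<Sum>b\<in>?D. ?w b * (?w a * (f a * g a)))
      + (\<Sum>a\<in>?D. \<Sum>b\<in>?D. ?w a * (?w b * (f b * g b)))
      - (\<Sum>a\<in>?D. \<Sum>b\<in>?D. (?w a * f a) * (?w b * g b))
      - (\<Sum>a\<in>?D. \<Sum>b\<in>?D. (?w a * g a) * (?w b * f b))"
    unfolding sum.distrib[symmetric] sum_subtractf[symmetric]
    by (intro sum.cong refl) (simp add: algebra_simps)
  also have "\<dots> = 2 * ((\<Sum>a\<in>?D. ?w a) * (\<Sum>a\<in>?D. ?w a * (f a * g a)))
      - 2 * ((\<Sum>a\<in>?D. ?w a * f a) * (\<Sum>a\<in>?D. ?w a * g a))"
    unfolding sum_distrib_left[symmetric] sum_distrib_right[symmetric] by simp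
  also have "(\<Sum>a\<in>?D. ?w a) = real (p ^ k)"
    by (metis of_nat_sum totient_divisor_sum)
  finally show "(\<Sum>d\<in>?D. ?w d * f d) * (\<Sum>d\<in>?D. ?w d * g d)
      \<le> real (p ^ k) * (\<Sum>d\<in>?D. ?w d * (f d * g d))"
    by simp
qed

lemma positively_correlated:
  assumes "n > 0"
  shows "positively_correlated n"
  using assms
proof (induction n rule: less_induct)
  case (less n)
  show ?case
  proof (cases "n = 1")
    case True
    then show ?thesis
      using positively_correlated_prime_power[OF two_is_prime_nat, of 0] by simp
  next
    case False
    then obtain p where p: "prime p" "p dvd n"
      using prime_factor_nat by blast
    define m where "m = n div p ^ multiplicity p n"
    have n: "n = p ^ multiplicity p n * m"
      unfolding m_def by (simp add: multiplicity_dvd)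
    have "\<not> p dvd m"
      using less.prems p multiplicity_decompose[of n p] unfolding m_def by (simp add: prime_nat_iff)
    then have "coprime (p ^ multiplicity p n) m"
      using p(1) prime_imp_coprime coprime_power_left_iff by blast
    moreover have "0 < m"
      using less.prems n by (cases m) auto
    moreover have "m < n"
      using \<open>\<not> p dvd m\<close> p(2) n \<open>0 < m\<close> less.prems
      by (metis dvd_triv_right le_neq_implies_less dvd_imp_le)
    ultimately show ?thesis
      using positively_correlated_coprime_mult positively_correlated_prime_power[OF p(1)]
        less.IH n by metis
  qed
qed

lemma downward_closed_divisors_correlation:
  assumes n: "n > 0"
    and P: "\<And>a b. a dvd b \<Longrightarrow> b dvd n \<Longrightarrow> P b \<Longrightarrow> P a"
    and Q: "\<And>a b. a dvd b \<Longrightarrow> b dvd n \<Longrightarrow> Q b \<Longrightarrow> Q a"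
  shows "(\<Sum>d | d dvd n \<and> P d. totient d) * (\<Sum>d | d dvd n \<and> Q d. totient d)
           \<le> n * (\<Sum>d | d dvd n \<and> P d \<and> Q d. totient d)"
proof -
  have ind: "(\<Sum>d | d dvd n. real (totient d) * of_bool (R d)) = real (\<Sum>d | d dvd n \<and> R d. totient d)"
    for R
    unfolding of_nat_sum using n by (intro sum.mono_neutral_cong_right) auto
  have "(\<Sum>d | d dvd n. real (totient d) * of_bool (P d)) * (\<Sum>d | d dvd n. real (totient d) * of_bool (Q d))
          \<le> real n * (\<Sum>d | d dvd n. real (totient d) * (of_bool (P d) * of_bool (Q d)))"
    using P Q by (intro positively_correlatedD[OF positively_correlated[OF n]]) auto
  then have "real ((\<Sum>d | d dvd n \<and> P d. totient d) * (\<Sum>d | d dvd n \<and> Q d. totient d))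
           \<le> real (n * (\<Sum>d | d dvd n \<and> P d \<and> Q d. totient d))"
    unfolding of_bool_conj[symmetric] ind by simp
  then show ?thesis
    by (simp only: of_nat_le_iff)
qed

section \<open>Power graphs of cyclic groups\<close>

lemma disconnected_iff:
  assumes "verts \<Gamma> \<noteq> {}"
  shows "\<not> Digraph_Component.connected \<Gamma> \<longleftrightarrow>
    (\<exists>A B. A \<noteq> {} \<and> B \<noteq> {} \<and> A \<inter> B = {} \<and> A \<union> B = verts \<Gamma> \<and>
       (\<forall>a\<in>A. \<forall>b\<in>B. (a, b) \<notin> (arcs_ends \<Gamma>)\<^sup>s))"
    (is "?L \<longleftrightarrow> ?R")
proof
  assume ?L
  then obtain u v where uv: "u \<in> verts \<Gamma>" "v \<in> verts \<Gamma>"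
    "(u, v) \<notin> rtrancl_on (verts \<Gamma>) ((arcs_ends \<Gamma>)\<^sup>s)"
    using assms by (auto simp: connected_conv)
  define A where "A = {w \<in> verts \<Gamma>. (u, w) \<in> rtrancl_on (verts \<Gamma>) ((arcs_ends \<Gamma>)\<^sup>s)}"
  have "(a, b) \<notin> (arcs_ends \<Gamma>)\<^sup>s" if "a \<in> A" "b \<in> verts \<Gamma> - A" for a b
    using that rtrancl_on_into_rtrancl_on[of u a _ _ b] unfolding A_def by blast
  moreover have "u \<in> A" "v \<in> verts \<Gamma> - A" "A \<subseteq> verts \<Gamma>"
    using uv by (auto simp: A_def)
  ultimately show ?R
    by (intro exI[of _ A] exI[of _ "verts \<Gamma> - A"] conjI ballI) auto
next
  assume ?R
  then obtain A B where AB: "A \<noteq> {}" "B \<noteq> {}" "A \<inter> B = {}" "A \<union> B = verts \<Gamma>"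
    "\<forall>a\<in>A. \<forall>b\<in>B. (a, b) \<notin> (arcs_ends \<Gamma>)\<^sup>s"
    by (elim exE conjE)
  then obtain u v where "u \<in> A" "v \<in> B"
    by blast
  have "w \<in> A" if "(u, w) \<in> rtrancl_on (verts \<Gamma>) ((arcs_ends \<Gamma>)\<^sup>s)" for w
    using that
  proof (induction rule: rtrancl_on_induct)
    case base
    show ?case
      by (rule \<open>u \<in> A\<close>)
  next
    case (step b c)
    then show ?case
      using AB(4,5) by blast
  qed
  then have "(u, v) \<notin> rtrancl_on (verts \<Gamma>) ((arcs_ends \<Gamma>)\<^sup>s)"
    using \<open>v \<in> B\<close> AB(3) by blast
  then show ?L
    using \<open>u \<in> A\<close> \<open>v \<in> B\<close> AB(4) by (auto simp: connected_conv)
qed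

lemma (in group) cyclic_group_generator:
  assumes "cyclic_group G" "finite (carrier G)"
  obtains g where "g \<in> carrier G" "ord g = order G"
    "bij_betw (\<lambda>k::nat. g [^] k) {0<..order G} (carrier G)"
proof -
  obtain g where g: "g \<in> carrier G" "subgroup_generated G {g} = G"
    using assms(1) unfolding cyclic_group_def by blast
  have ord: "ord g = order G"
    using cyclic_order_is_ord[OF g(1)] g(2) by simp
  have "inj_on (\<lambda>k::nat. g [^] k) {0<..order G}"
  proof -
    have "{0<..order G} = {1..order G}"
      by auto
    then show ?thesis
      using ord_inj'[OF g(1)] ord by simp
  qed
  moreover have "(\<lambda>k::nat. g [^] k) ` {0<..order G} = carrier G"
    using calculation assms(2) g(1)
    by (intro card_subset_eq) (auto simp: card_image order_def)
  ultimately show thesis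
    using that g(1) ord unfolding bij_betw_def by blast
qed

lemma (in group) pow_cong:
  assumes "x \<in> carrier G" "[a = b] (mod ord x)"
  shows "x [^] a = x [^] (b::nat)"
proof -
  have "x [^] k = x [^] (k mod ord x)" for k :: nat
  proof -
    have "x [^] k = x [^] (ord x * (k div ord x) + k mod ord x)"
      by simp
    also have "\<dots> = (x [^] ord x) [^] (k div ord x) \<otimes> x [^] (k mod ord x)"
      using assms(1) by (simp only: nat_pow_mult[symmetric] nat_pow_pow)
    finally show ?thesis
      using assms(1) by simp
  qed
  then show ?thesis
    using assms(2) by (metis cong_def)
qed

lemma (in group) cyclic_group_power_iff_ord_dvd:
  assumes "cyclic_group G" "finite (carrier G)" and xy: "x \<in> carrier G" "y \<in> carrier G"
  shows "(\<exists>k::nat. y = x [^] k) \<longleftrightarrow> ord y dvd ord x"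
proof
  assume "\<exists>k::nat. y = x [^] k"
  then show "ord y dvd ord x"
    using xy by (metis nat_pow_one nat_pow_pow pow_eq_id pow_ord_eq_1 mult.commute)
next
  assume dvd: "ord y dvd ord x"
  obtain g where g: "g \<in> carrier G" "ord g = order G"
    and bij: "bij_betw (\<lambda>k::nat. g [^] k) {0<..order G} (carrier G)"
    using cyclic_group_generator assms(1,2) by blast
  obtain a b :: nat where a: "x = g [^] a" "0 < a" and b: "y = g [^] b" "0 < b"
    using bij xy unfolding bij_betw_def by (metis greaterThanAtMost_iff imageE)
  let ?n = "order G"
  have n: "?n > 0"
    using assms(2) by (simp add: order_gt_0_iff_finite)
  have "g [^] (b * ord x) = \<one>"
    using b(1) dvd g(1) xy by (metis nat_pow_pow pow_eq_id)
  then have "?n dvd b * (?n div gcd ?n a)"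
    using a g by (simp add: pow_eq_id ord_pow_gen)
  moreover obtain m where m: "?n = gcd ?n a * m"
    by (meson dvdE gcd_dvd1)
  moreover have "?n div gcd ?n a = m"
    using m n by (metis nat_0_less_mult_iff nonzero_mult_div_cancel_left less_numeral_extra(3))
  ultimately have "gcd ?n a * m dvd b * m" "0 < m"
    using n by (metis, metis mult_0_right neq0_conv)
  then have "gcd a ?n dvd b"
    by (simp add: gcd.commute)
  then obtain c where c: "b = gcd a ?n * c"
    by (rule dvdE)
  obtain k where "[a * k = gcd a ?n] (mod ?n)"
    using cong_solve_nat[of a ?n] a(2) by blast
  then have "[a * (k * c) = b] (mod ?n)"
    using cong_scalar_right[of "a * k" "gcd a ?n" ?n c] c by (simp add: mult.assoc)
  then have "g [^] (a * (k * c)) = g [^] b"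
    using g pow_cong by metis
  then show "\<exists>k::nat. y = x [^] k"
    using a b g by (metis nat_pow_pow)
qed

lemma (in group) card_elems_of_order_cyclic:
  assumes "cyclic_group G" "finite (carrier G)" "d dvd order G"
  shows "card (elems_of_order G d) = totient d"
proof -
  obtain g where g: "g \<in> carrier G" "ord g = order G"
    and bij: "bij_betw (\<lambda>k::nat. g [^] k) {0<..order G} (carrier G)"
    using cyclic_group_generator assms(1,2) by blast
  let ?n = "order G"
  have n: "?n > 0"
    using assms(2) by (simp add: order_gt_0_iff_finite)
  have iff: "ord (g [^] k) = d \<longleftrightarrow> gcd k ?n = ?n div d" if "k \<in> {0<..?n}" for k :: nat
  proof -
    have "?n div gcd k ?n = d \<longleftrightarrow> gcd k ?n = ?n div d"
      using n assms(3) 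
      by (metis dvd_mult_div_cancel gcd_dvd2 nat_0_less_mult_iff nonzero_mult_div_cancel_right
        zero_less_iff_neq_zero)
    then show ?thesis
      using that g by (simp add: ord_pow_gen gcd.commute)
  qed
  have "elems_of_order G d = (\<lambda>k. g [^] k) ` {k \<in> {0<..?n}. gcd k ?n = ?n div d}"
  proof -
    have "elems_of_order G d = {x \<in> (\<lambda>k::nat. g [^] k) ` {0<..?n}. ord x = d}"
      using bij unfolding elems_of_order_def bij_betw_def by simp
    also have "\<dots> = (\<lambda>k. g [^] k) ` {k \<in> {0<..?n}. ord (g [^] k) = d}"
      by auto
    also have "{k \<in> {0<..?n}. ord (g [^] k) = d} = {k \<in> {0<..?n}. gcd k ?n = ?n div d}"
      using iff by blast
    finally show ?thesis .
  qed
  moreover have "inj_on (\<lambda>k::nat. g [^] k) {k \<in> {0<..?n}. gcd k ?n = ?n div d}"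
    using bij unfolding bij_betw_def by (auto intro: inj_on_subset)
  ultimately have "card (elems_of_order G d) = card {k \<in> {0<..?n}. gcd k ?n = ?n div d}"
    by (simp add: card_image)
  also have "\<dots> = totient d"
    using n assms(3) by (subst card_gcd_eq_totient) (auto simp: div_div_eq_right)
  finally show ?thesis .
qed

lemma (in group) card_ord_cyclic:
  assumes "cyclic_group G" "finite (carrier G)"
  shows "card {x \<in> carrier G. P (ord x)} = (\<Sum>d | d dvd order G \<and> P d. totient d)"
proof -
  have "{x \<in> carrier G. P (ord x)} = (\<Union>d \<in> {d. d dvd order G \<and> P d}. elems_of_order G d)"
    using ord_dvd_group_order by (auto simp: elems_of_order_def)
  also have "card \<dots> = (\<Sum>d | d dvd order G \<and> P d. card (elems_of_order G d))"
    using assms(2) 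
    by (intro card_UN_disjoint) (auto simp: elems_of_order_def order_gt_0_iff_finite)
  also have "\<dots> = (\<Sum>d | d dvd order G \<and> P d. totient d)"
    using card_elems_of_order_cyclic assms by simp
  finally show ?thesis .
qed

lemma (in group) cut_set_power_graph_iff:
  assumes "cyclic_group G" "finite (carrier G)"
  shows "cut_set (power_graph G) X \<longleftrightarrow> X \<subseteq> carrier G \<and>
    (\<exists>A B. A \<noteq> {} \<and> B \<noteq> {} \<and> A \<inter> B = {} \<and> A \<union> B = carrier G - X \<and>
       (\<forall>a\<in>A. \<forall>b\<in>B. \<not> ord a dvd ord b \<and> \<not> ord b dvd ord a))"
proof (cases "X \<subset> carrier G")
  case True
  let ?\<Gamma> = "remove_verts (power_graph G) X"
  have verts: "verts ?\<Gamma> = carrier G - X"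
    by (simp add: remove_verts_def power_graph_def)
  have arcs: "(a, b) \<in> (arcs_ends ?\<Gamma>)\<^sup>s \<longleftrightarrow> a \<noteq> b \<and> (ord a dvd ord b \<or> ord b dvd ord a)"
    if "a \<in> carrier G - X" "b \<in> carrier G - X" for a b
    using that cyclic_group_power_iff_ord_dvd[OF assms]
    by (auto simp: remove_verts_def power_graph_def induce_subgraph_def symcl_def arcs_ends_conv image_iff)
  have sep: "(\<forall>a\<in>A. \<forall>b\<in>B. (a, b) \<notin> (arcs_ends ?\<Gamma>)\<^sup>s) \<longleftrightarrow>
        (\<forall>a\<in>A. \<forall>b\<in>B. \<not> ord a dvd ord b \<and> \<not> ord b dvd ord a)"
    if "A \<inter> B = {}" "A \<union> B = carrier G - X" for A B
  proof (intro ball_cong refl)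
    fix a b assume "a \<in> A" "b \<in> B"
    then show "(a, b) \<notin> (arcs_ends ?\<Gamma>)\<^sup>s \<longleftrightarrow> \<not> ord a dvd ord b \<and> \<not> ord b dvd ord a"
      using that arcs[of a b] by blast
  qed
  have "cut_set (power_graph G) X \<longleftrightarrow> \<not> Digraph_Component.connected ?\<Gamma>"
    using True by (simp add: cut_set_def power_graph_def)
  also have "\<dots> \<longleftrightarrow> (\<exists>A B. A \<noteq> {} \<and> B \<noteq> {} \<and> A \<inter> B = {} \<and> A \<union> B = carrier G - X \<and>
       (\<forall>a\<in>A. \<forall>b\<in>B. (a, b) \<notin> (arcs_ends ?\<Gamma>)\<^sup>s))"
    using True by (subst disconnected_iff) (auto simp only: verts)
  also have "\<dots> \<longleftrightarrow> (\<exists>A B. A \<noteq> {} \<and> B \<noteq> {} \<and> A \<inter> B = {} \<and> A \<union> B = carrier G - X \<and>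
       (\<forall>a\<in>A. \<forall>b\<in>B. \<not> ord a dvd ord b \<and> \<not> ord b dvd ord a))"
    by (intro ex_cong1 conj_cong refl sep)
  finally show ?thesis
    using psubset_imp_subset[OF True] by simp
next
  case False
  then show ?thesis
    by (auto simp: cut_set_def power_graph_def)
qed

lemma vertex_connectivity_eq_card_min_cut_set:
  assumes "min_cut_set \<Gamma> X" "finite (verts \<Gamma>)"
  shows "vertex_connectivity \<Gamma> = card X"
  unfolding vertex_connectivity_def
proof (rule Least_equality)
  show "\<exists>Y\<subseteq>verts \<Gamma>. card Y = card X \<and> (cut_set \<Gamma> Y \<or> card (verts (remove_verts \<Gamma> Y)) = 1)"
    using assms by (auto simp: min_cut_set_def cut_set_def)
next
  fix k assume "\<exists>Y\<subseteq>verts \<Gamma>. card Y = k \<and> (cut_set \<Gamma> Y \<or> card (verts (remove_verts \<Gamma> Y)) = 1)"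
  then obtain Y where Y: "Y \<subseteq> verts \<Gamma>" "card Y = k"
    "cut_set \<Gamma> Y \<or> card (verts (remove_verts \<Gamma> Y)) = 1"
    by blast
  have "card X < card (verts \<Gamma>)"
    using assms by (auto simp: min_cut_set_def cut_set_def intro: psubset_card_mono)
  moreover have "card (verts (remove_verts \<Gamma> Y)) = card (verts \<Gamma>) - card Y"
    using Y(1) assms(2) by (simp add: remove_verts_def card_Diff_subset finite_subset)
  ultimately show "card X \<le> k"
    using Y assms(1) by (auto simp: min_cut_set_def)
qed

section \<open>Totients and densities\<close>

lemma totient_prod_prime_powers:
  fixes p f :: "'a \<Rightarrow> nat"
  assumes "finite I" "inj_on p I" "\<And>k. k \<in> I \<Longrightarrow> prime (p k)" "\<And>k. k \<in> I \<Longrightarrow> f k > 0"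
  shows "real (totient (\<Prod>k\<in>I. p k ^ f k)) = real (\<Prod>k\<in>I. p k ^ f k) * (\<Prod>k\<in>I. 1 - 1 / real (p k))"
proof -
  have "prime_factors (\<Prod>k\<in>I. p k ^ f k) = (\<Union>k\<in>I. prime_factors (p k ^ f k))"
    using assms by (subst prime_factors_prod) (auto simp: image_iff dest: prime_gt_0_nat)
  also have "\<dots> = p ` I"
    using assms by (auto simp: prime_factors_power prime_factorization_prime)
  finally show ?thesis
    using assms(2) by (simp add: totient_formula2 prod.reindex)
qed

lemma sum_totient_multiples:
  fixes a b :: nat
  assumes "coprime a b" "a > 0"
  shows "(\<Sum>d | a dvd d \<and> d dvd a * b. totient d) = totient a * b"
proof -
  have "{d. a dvd d \<and> d dvd a * b} = (\<lambda>y. a * y) ` {y. y dvd b}"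
    using assms(2) by (auto elim!: dvdE[of a])
  moreover have "inj_on (\<lambda>y. a * y) {y. y dvd b}"
    using assms(2) by (simp add: inj_on_def)
  ultimately have "(\<Sum>d | a dvd d \<and> d dvd a * b. totient d) = (\<Sum>y | y dvd b. totient (a * y))"
    by (simp add: sum.reindex)
  also have "\<dots> = (\<Sum>y | y dvd b. totient a * totient y)"
    using coprime_divisors[OF dvd_refl _ assms(1)]
    by (intro sum.cong) (auto simp: totient_mult_coprime)
  finally show ?thesis
    by (simp add: totient_divisor_sum flip: sum_distrib_left)
qed

lemma totient_prime_mult_le:
  assumes "prime p"
  shows "totient (p * m) \<le> p * totient m"
proof (cases "coprime p m")
  case True
  then show ?thesis
    using assms by (simp add: totient_mult_coprime totient_prime)
next
  case False
  then have "gcd p m = p"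
    using assms by (metis coprime_commute gcd_nat.absorb_iff1 prime_imp_coprime)
  then show ?thesis
    using totient_gcd[of p m] prime_gt_1_nat[OF assms] by (auto simp: totient_prime[OF assms])
qed

locale prime_power_product =
  fixes n r :: nat and p e :: "nat \<Rightarrow> nat"
  assumes n_eq: "n = (\<Prod>i=1..r. p i ^ e i)"
    and prime_p: "\<And>i. i \<in> {1..r} \<Longrightarrow> prime (p i)"
    and p_mono: "strict_mono_on {1..r} p"
    and e_pos: "\<And>i. i \<in> {1..r} \<Longrightarrow> e i \<ge> 1"
begin

definition cofactor :: "nat \<Rightarrow> nat" where
  "cofactor i = (\<Prod>k\<in>{1..r} - {i}. p k ^ e k)"

definition density :: "nat \<Rightarrow> real" where
  "density i = (\<Prod>k\<in>{1..r} - {i}. 1 - 1 / real (p k))"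

definition cut_ratio :: "nat \<Rightarrow> nat \<Rightarrow> real" where
  "cut_ratio i s = density i + (1 - 2 * density i) / real (p i ^ s)"

lemma inj_p: "inj_on p {1..r}"
  using p_mono by (rule strict_mono_on_imp_inj_on)

lemma p_less: "i \<in> {1..r} \<Longrightarrow> j \<in> {1..r} \<Longrightarrow> i < j \<Longrightarrow> p i < p j"
  using p_mono by (auto simp: strict_mono_on_def)

lemma p_ge_2: "i \<in> {1..r} \<Longrightarrow> p i \<ge> 2"
  using prime_p prime_ge_2_nat by blast

lemma n_pos: "n > 0"
  unfolding n_eq using p_ge_2 by (intro prod_pos) fastforce

lemma cofactor_pos: "cofactor i > 0"
  unfolding cofactor_def using p_ge_2 by (intro prod_pos) fastforce

lemma n_eq_cofactor:
  assumes "i \<in> {1..r}"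
  shows "n = cofactor i * p i ^ e i"
  using assms unfolding n_eq cofactor_def by (subst prod.remove[of _ i]) (auto simp: mult_ac)

lemma coprime_p: "i \<in> {1..r} \<Longrightarrow> k \<in> {1..r} \<Longrightarrow> i \<noteq> k \<Longrightarrow> coprime (p i) (p k)"
  using prime_p inj_p by (metis inj_onD primes_coprime)

lemma coprime_cofactor:
  assumes "i \<in> {1..r}"
  shows "coprime (cofactor i) (p i ^ t)"
  unfolding cofactor_def using assms coprime_p
  by (intro prod_coprime_left coprime_power_left_iff[THEN iffD2] disjI1 coprime_power_right_iff[THEN iffD2]) auto

lemma prime_dvd_cofactor:
  assumes "prime q" "q dvd cofactor i"
  obtains k where "k \<in> {1..r} - {i}" "q = p k"
proof -
  have "\<exists>k \<in> {1..r} - {i}. q dvd p k ^ e k"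
    using assms unfolding cofactor_def by (simp add: prime_dvd_prod_iff)
  then obtain k where "k \<in> {1..r} - {i}" "q dvd p k ^ e k"
    by blast
  moreover then have "q = p k"
    using assms(1) prime_p by (metis DiffE prime_dvd_power primes_dvd_imp_eq)
  ultimately show thesis
    using that by blast
qed

lemma p_dvd_cofactor: "k \<in> {1..r} - {i} \<Longrightarrow> p k dvd cofactor i"
  unfolding cofactor_def using e_pos[of k]
  by (intro dvd_trans[OF _ dvd_prodI]) (auto intro: dvd_power)

lemma p_dvd_n: "k \<in> {1..r} \<Longrightarrow> p k dvd n"
  using n_eq_cofactor[of k] e_pos[of k] by (metis dvd_mult dvd_power less_le_trans zero_less_one)

lemma prime_dvd_n:
  assumes "prime q" "q dvd n"
  obtains k where "k \<in> {1..r}" "q = p k"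
proof -
  have "\<exists>k \<in> {1..r}. q dvd p k ^ e k"
    using assms unfolding n_eq by (simp add: prime_dvd_prod_iff)
  then obtain k where "k \<in> {1..r}" "q dvd p k ^ e k"
    by blast
  moreover then have "q = p k"
    using assms(1) prime_p by (metis prime_dvd_power primes_dvd_imp_eq)
  ultimately show thesis
    using that by blast
qed

lemma dvd_maximal_divisor:
  assumes "d dvd n" "d \<noteq> n"
  obtains k where "k \<in> {1..r}" "d dvd n div p k"
proof -
  obtain m where m: "n = d * m"
    using assms(1) by (rule dvdE)
  then have "m \<noteq> 1"
    using assms(2) by auto
  then obtain q where q: "prime q" "q dvd m"
    using prime_factor_nat by blast
  then obtain k where k: "k \<in> {1..r}" "q = p k"
    using prime_dvd_n m by (metis dvd_mult)
  have "d dvd n div p k"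
    using q k m by (metis div_mult_swap dvd_triv_left)
  then show thesis
    using that k by blast
qed

lemma cofactor_dvd_iff:
  assumes i: "i \<in> {1..r}" and d: "d dvd cofactor i * p i ^ t"
  shows "\<not> cofactor i dvd d \<longleftrightarrow> (\<exists>k \<in> {1..r} - {i}. d dvd cofactor i div p k * p i ^ t)"
proof
  assume nd: "\<not> cofactor i dvd d"
  obtain x y where xy: "d = x * y" "x dvd cofactor i" "y dvd p i ^ t"
    using division_decomp[OF d] by blast
  obtain m where m: "cofactor i = x * m"
    using xy(2) by (rule dvdE)
  have "m \<noteq> 1"
    using nd xy m by auto
  then obtain q where q: "prime q" "q dvd m"
    using prime_factor_nat by blast
  then obtain k where k: "k \<in> {1..r} - {i}" "q = p k"
    using prime_dvd_cofactor m by (metis dvd_mult)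
  have "x dvd cofactor i div p k"
    using q k m by (metis div_mult_swap dvd_triv_left)
  then show "\<exists>k \<in> {1..r} - {i}. d dvd cofactor i div p k * p i ^ t"
    using k xy by (intro bexI[of _ k]) (auto intro: mult_dvd_mono)
next
  assume "\<exists>k \<in> {1..r} - {i}. d dvd cofactor i div p k * p i ^ t"
  then obtain k where k: "k \<in> {1..r} - {i}" "d dvd cofactor i div p k * p i ^ t"
    by blast
  show "\<not> cofactor i dvd d"
  proof
    assume "cofactor i dvd d"
    then have "cofactor i dvd cofactor i div p k * p i ^ t"
      using k(2) dvd_trans by blast
    then have "cofactor i dvd cofactor i div p k"
      using coprime_cofactor[OF i] coprime_dvd_mult_left_iff by blast
    moreover have "cofactor i div p k > 0" "cofactor i div p k < cofactor i"
      using cofactor_pos[of i] p_dvd_cofactor[OF k(1)] p_ge_2[of k] k(1)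
      by (auto simp: dvd_div_eq_0_iff intro: Nat.gr0I)
    ultimately show False
      by (meson dvd_imp_le leD)
  qed
qed

lemma between_cofactor:
  assumes i: "i \<in> {1..r}" and "cofactor i dvd d" "d dvd cofactor i * p i ^ t"
  obtains j where "j \<le> t" "d = cofactor i * p i ^ j"
proof -
  obtain y where y: "d = cofactor i * y"
    using assms(2) by (rule dvdE)
  then have "y dvd p i ^ t"
    using assms(3) cofactor_pos[of i] by simp
  then have "\<exists>j\<le>t. y = p i ^ j"
    using divides_primepow_nat[OF prime_p[OF i]] by simp
  then show thesis
    using that y by blast
qed

lemma n_div_prime_power:
  assumes "i \<in> {1..r}" "s \<le> e i"
  shows "n div p i ^ s = cofactor i * p i ^ (e i - s)"
  using assms p_ge_2[OF assms(1)]
  by (subst n_eq_cofactor[of i]) (auto simp: power_diff div_mult_swap le_imp_power_dvd)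

lemma n_div_primes:
  assumes "i \<in> {1..r}" "s \<le> e i" "k \<in> {1..r} - {i}"
  shows "n div (p k * p i ^ s) = cofactor i div p k * p i ^ (e i - s)"
  using n_div_prime_power[OF assms(1,2)] p_dvd_cofactor[OF assms(3)]
  by (metis div_mult2_eq dvd_div_mult mult.commute)

lemma totient_cofactor: "real (totient (cofactor i)) = cofactor i * density i"
  unfolding cofactor_def density_def
  using prime_p e_pos inj_p
  by (intro totient_prod_prime_powers) (auto intro: inj_on_subset simp: Suc_le_eq)

lemma density_pos: "density i > 0"
  unfolding density_def using p_ge_2 by (intro prod_pos) (force simp: field_simps)

lemma density_mult:
  assumes "i \<in> {1..r}"
  shows "density i * (1 - 1 / real (p i)) = (\<Prod>k=1..r. 1 - 1 / real (p k))"
  using assms unfolding density_def by (subst prod.remove[of "{1..r}" i]) auto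

lemma totient_n:
  assumes "i \<in> {1..r}"
  shows "real (totient n) = n * density i * (1 - 1 / real (p i))"
  unfolding mult.assoc density_mult[OF assms] n_eq
  using prime_p e_pos inj_p
  by (intro totient_prod_prime_powers) (auto simp: Suc_le_eq)

lemma prod_p_div:
  assumes "i \<in> {1..r}"
  shows "(\<Prod>k=1..r. p k) div p i = (\<Prod>k\<in>{1..r} - {i}. p k)"
  using assms p_ge_2[OF assms] by (subst prod.remove[of _ i]) auto

lemma totient_prod_p_div:
  assumes "i \<in> {1..r}"
  shows "real (totient ((\<Prod>k=1..r. p k) div p i)) = real ((\<Prod>k=1..r. p k) div p i) * density i"
  using totient_prod_prime_powers[of "{1..r} - {i}" p "\<lambda>_. 1"] prime_p inj_p
  unfolding prod_p_div[OF assms] density_def by (auto intro: inj_on_subset)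

lemma totient_prod_p_div_less_iff:
  assumes "i \<in> {1..r}"
  shows "2 * totient ((\<Prod>k=1..r. p k) div p i) < (\<Prod>k=1..r. p k) div p i \<longleftrightarrow> density i < 1 / 2"
proof -
  have "(\<Prod>k=1..r. p k) div p i > 0"
    unfolding prod_p_div[OF assms] using p_ge_2 by (intro prod_pos) fastforce
  moreover have "2 * totient ((\<Prod>k=1..r. p k) div p i) < (\<Prod>k=1..r. p k) div p i \<longleftrightarrow>
      2 * real (totient ((\<Prod>k=1..r. p k) div p i)) < real ((\<Prod>k=1..r. p k) div p i)"
    by (metis of_nat_less_iff of_nat_mult of_nat_numeral)
  ultimately show ?thesis
    unfolding totient_prod_p_div[OF assms] by (auto simp: field_simps)
qed

lemma beta_eq_cut_ratio:
  assumes "i \<in> {1..r}" "s \<ge> 1"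
  shows "beta n r p i s = n * cut_ratio i s"
proof -
  let ?P = "\<Prod>k=1..r. p k"
  have P: "real ?P > 0"
    using p_ge_2 by (auto intro!: prod_pos simp: Suc_le_eq) fastforce
  have div: "real (?P div p i) = real ?P / real (p i)"
    using assms(1) by (intro real_of_nat_div) auto
  have pow: "real (p i ^ s) = real (p i) * real (p i ^ (s - 1))"
    using assms(2) by (cases s) auto
  have pi: "real (p i) > 0" "real (p i ^ (s - 1)) > 0"
    using p_ge_2[OF assms(1)] by auto
  have alg: "n * d * (1 - 1 / q) + n / Q * (1 / u) * (Q / q + Q / q * d * (u - 2)) = n * (d + (1 - 2 * d) / (q * u))"
    if "Q > 0" "q > 0" "u > 0" for n d q Q u :: real
    using that by (simp add: field_simps)
  show ?thesis
    unfolding beta_def cut_ratio_def totient_n[OF assms(1)] totient_prod_p_div[OF assms(1)] div pow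
    using alg[OF P pi] by simp
qed

end

section \<open>Comparison of the candidate cut-sets\<close>

context prime_power_product
begin

lemma p_gap:
  assumes "i \<in> {1..r}" "j \<in> {1..r}" "i < j" "3 \<le> j"
  shows "p i + 2 \<le> p j"
proof (cases "i = 1")
  case True
  then have "p i < p 2" "p 2 < p j"
    using assms by (auto intro: p_less)
  then show ?thesis
    by simp
next
  case False
  then have "2 < p i"
    using p_ge_2[of 1] p_less[of 1 i] assms by simp
  moreover have "p i < p j"
    using assms by (intro p_less) auto
  ultimately have "odd (p i)" "odd (p j)"
    using assms prime_p prime_odd_nat by (meson less_trans)+
  then show ?thesis
    using \<open>p i < p j\<close> by presburger
qed

lemma p_ge_odd:
  assumes "2 \<le> k" "k \<le> r"
  shows "2 * k - 1 \<le> p k"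
  using assms
proof (induction k rule: dec_induct)
  case base
  then show ?case
    using p_ge_2[of 1] p_less[of 1 2] by simp
next
  case (step k)
  then show ?case
    using p_gap[of k "Suc k"] by simp
qed

lemma p_power_ge:
  assumes "i \<in> {1..r}" "t \<le> s"
  shows "2 ^ t \<le> real (p i ^ s)"
proof -
  have "(2::real) ^ t \<le> 2 ^ s"
    using assms(2) by (rule power_increasing) simp
  also have "\<dots> \<le> real (p i) ^ s"
    using p_ge_2[OF assms(1)] by (intro power_mono) auto
  finally show ?thesis
    by simp
qed

definition partial_density :: "nat \<Rightarrow> real" where
  "partial_density m = (\<Prod>k=1..m. 1 - 1 / real (p k))"

lemma density_r: "r \<ge> 1 \<Longrightarrow> r - 1 = m \<Longrightarrow> density r = partial_density m"
  unfolding density_def partial_density_def by (rule prod.cong) auto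

lemma partial_density_Suc:
  "partial_density (Suc m) = partial_density m * (1 - 1 / real (p (Suc m)))"
  by (simp add: partial_density_def)

lemma partial_density_step:
  assumes "1 \<le> m" "Suc m \<le> r" "c \<le> partial_density m" "0 \<le> c"
  shows "c * (1 - 1 / (2 * real m + 1)) \<le> partial_density (Suc m)"
proof -
  have "2 * m + 1 \<le> p (Suc m)"
    using p_ge_odd[of "Suc m"] assms by simp
  then have "2 * real m + 1 \<le> real (p (Suc m))"
    by linarith
  then have "1 - 1 / (2 * real m + 1) \<le> 1 - 1 / real (p (Suc m))"
    by (simp add: frac_le)
  then show ?thesis
    unfolding partial_density_Suc using assms by (intro mult_mono) auto
qed

lemma partial_density_3: "3 \<le> r \<Longrightarrow> 4 / 15 \<le> partial_density 3"
proof -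
  assume "3 \<le> r"
  then have "1 / 2 \<le> partial_density 1"
    using p_ge_2[of 1] by (simp add: partial_density_def field_simps)
  then have "1 / 3 \<le> partial_density 2"
    using partial_density_step[of 1 "1 / 2"] \<open>3 \<le> r\<close> by (simp add: numeral_2_eq_2)
  then show ?thesis
    using partial_density_step[of 2 "1 / 3"] \<open>3 \<le> r\<close> by (simp add: numeral_3_eq_3)
qed

lemma partial_density_4: "4 \<le> r \<Longrightarrow> 8 / 35 \<le> partial_density 4"
  using partial_density_step[of 3 "4 / 15"] partial_density_3 by simp

lemma partial_density_ge_inverse:
  assumes "5 \<le> m" "m \<le> r"
  shows "1 / real m \<le> partial_density m"
  using assms
proof (induction m rule: dec_induct)
  case base
  then show ?case
    using partial_density_step[of 4 "8 / 35"] partial_density_4 by simp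
next
  case (step m)
  have "1 / real (Suc m) \<le> 1 / real m * (1 - 1 / (2 * real m + 1))"
    using step(1) by (simp add: field_simps)
  also have "\<dots> \<le> partial_density (Suc m)"
    using step by (intro partial_density_step) auto
  finally show ?case .
qed

lemma density_r_ge_inverse:
  assumes "4 \<le> r"
  shows "1 \<le> real r * density r"
proof -
  consider "r = 4" | "r = 5" | "6 \<le> r"
    using assms by linarith
  then show ?thesis
  proof cases
    case 1
    then have "4 / 15 \<le> density r" "real r = 4"
      using partial_density_3 density_r[of 3] by simp_all
    then show ?thesis
      by simp
  next
    case 2
    then have "8 / 35 \<le> density r" "real r = 5"
      using partial_density_4 density_r[of 4] by simp_all
    then show ?thesis
      by simp
  next
    case 3
    then have "1 / real (r - 1) \<le> density r"
      using partial_density_ge_inverse[of "r - 1"] density_r[of "r - 1"] by simp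
    then have "1 \<le> real (r - 1) * density r"
      using 3 by (simp add: field_simps)
    also have "\<dots> \<le> real r * density r"
      using density_pos[of r] by (intro mult_right_mono) auto
    finally show ?thesis .
  qed
qed

lemma p_r_ge: "2 \<le> r \<Longrightarrow> 2 * real r - 1 \<le> real (p r)"
proof -
  assume "2 \<le> r"
  then have "2 * r \<le> p r + 1"
    using p_ge_odd[of r] by simp
  then show ?thesis
    by linarith
qed

lemma density_cross:
  assumes "i \<in> {1..r}" "j \<in> {1..r}"
  shows "density i * (real (p i) - 1) * real (p j) = density j * (real (p j) - 1) * real (p i)"
proof -
  have "density i * (1 - 1 / real (p i)) = density j * (1 - 1 / real (p j))"
    using density_mult assms by simp
  then show ?thesis
    using p_ge_2[OF assms(1)] p_ge_2[OF assms(2)] by (simp add: field_simps)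
qed

lemma density_diff:
  assumes "i \<in> {1..r}" "j \<in> {1..r}"
  shows "density i - density j = density j * (real (p j) - real (p i)) / ((real (p i) - 1) * real (p j))"
proof -
  have "real (p i) - 1 > 0" "real (p j) > 0"
    using p_ge_2[OF assms(1)] p_ge_2[OF assms(2)] by linarith+
  then show ?thesis
    using density_cross[OF assms] by (simp add: divide_simps) (simp add: algebra_simps)
qed

lemma density_antimono:
  assumes "i \<in> {1..r}" "j \<in> {1..r}" "i \<le> j"
  shows "density j \<le> density i"
proof -
  have "p i \<le> p j"
    using assms p_less[of i j] by (cases "i = j") auto
  then have "density i - density j \<ge> 0"
    unfolding density_diff[OF assms(1,2)] using density_pos[of j] p_ge_2[OF assms(1)]
    by (intro divide_nonneg_nonneg mult_nonneg_nonneg) auto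
  then show ?thesis
    by simp
qed

lemma cut_ratio_less:
  assumes i: "i \<in> {1..r}" and j: "j \<in> {1..r}"
    and "density i < 1 / 2" "1 \<le> t"
    and gap: "(1 - 2 * density j) * (real (p i) - 1)
                \<le> density j * (real (p j) - real (p i)) * real (p j) ^ (t - 1)"
  shows "cut_ratio j t < cut_ratio i s"
proof -
  have pos: "real (p i) - 1 > 0" "real (p j) > 0"
    using p_ge_2[OF i] p_ge_2[OF j] by linarith+
  have "(1 - 2 * density j) / real (p j) ^ t
      \<le> density j * (real (p j) - real (p i)) / ((real (p i) - 1) * real (p j))"
    using gap pos \<open>1 \<le> t\<close> by (cases t) (simp_all add: divide_simps mult_ac)
  also have "\<dots> = density i - density j"
    using density_diff[OF i j] by simp
  finally have "cut_ratio j t \<le> density i"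
    by (simp add: cut_ratio_def)
  also have "density i < cut_ratio i s"
    using assms(3) pos by (simp add: cut_ratio_def)
  finally show ?thesis .
qed

lemma cut_ratio_antimono_exponent:
  assumes "i \<in> {1..r}" "density i < 1 / 2" "s < t"
  shows "cut_ratio i t < cut_ratio i s"
proof -
  have "real (p i) ^ s < real (p i) ^ t"
    using p_ge_2[OF assms(1)] assms(3) by (intro power_strict_increasing) auto
  then show ?thesis
    using assms(2) p_ge_2[OF assms(1)] unfolding cut_ratio_def
    by (auto intro!: divide_strict_left_mono)
qed

lemma cut_ratio_eq_half_iff:
  "cut_ratio i s = 1 / 2 - (1 / 2 - density i) * (1 - 2 / real (p i ^ s))"
  by (simp add: cut_ratio_def field_simps)

lemma cut_ratio_less_half:
  assumes "i \<in> {1..r}" "density i < 1 / 2" "2 \<le> s"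
  shows "cut_ratio i s < 1 / 2"
proof -
  have "2 < real (p i ^ s)"
    using p_power_ge[OF assms(1,3)] by simp
  then have "0 < (1 / 2 - density i) * (1 - 2 / real (p i ^ s))"
    using assms(2) by (intro mult_pos_pos) (auto simp: divide_less_eq_1)
  then show ?thesis
    unfolding cut_ratio_eq_half_iff by linarith
qed

lemma cut_ratio_ge_half:
  assumes "i \<in> {1..r}" "1 / 2 \<le> density i" "1 \<le> s"
  shows "1 / 2 \<le> cut_ratio i s"
proof -
  have "2 \<le> real (p i ^ s)"
    using p_power_ge[OF assms(1,3)] by simp
  then have "0 \<le> (density i - 1 / 2) * (1 - 2 / real (p i ^ s))"
    using assms(2) by (intro mult_nonneg_nonneg) (auto simp: divide_le_eq_1)
  then show ?thesis
    unfolding cut_ratio_eq_half_iff by (simp add: algebra_simps)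
qed

lemma cut_ratio_r_less_small_exponent:
  assumes "i \<in> {1..r}" "i < r" "density i < 1 / 2" "1 \<le> s" "s \<le> 2"
  shows "cut_ratio r 2 < cut_ratio i s"
proof -
  have r: "r \<in> {1..r}"
    using assms(1) by auto
  have "p i ^ s \<le> p i ^ 2" "p i ^ 2 < p r ^ 2"
    using assms p_ge_2[OF assms(1)] p_less[OF assms(1) r]
    by (auto intro: power_increasing power_strict_mono)
  then have "real (p i ^ s) < real (p r ^ 2)"
    by linarith
  have d: "density r \<le> density i"
    using density_antimono[OF assms(1) r] assms(2) by simp
  have "cut_ratio r 2 < density r + (1 - 2 * density r) / real (p i ^ s)"
    unfolding cut_ratio_def using d assms(3) p_ge_2[OF assms(1)] p_ge_2[OF r]
      \<open>real (p i ^ s) < _\<close>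
    by (intro add_strict_left_mono divide_strict_left_mono) auto
  also have "\<dots> \<le> cut_ratio i s"
  proof -
    have "2 \<le> real (p i ^ s)"
      using p_power_ge[OF assms(1,4)] by simp
    then have "0 \<le> (density i - density r) * (1 - 2 / real (p i ^ s))"
      using d by (intro mult_nonneg_nonneg) (auto simp: divide_le_eq_1)
    then show ?thesis
      by (simp add: cut_ratio_def diff_divide_distrib algebra_simps)
  qed
  finally show ?thesis .
qed

lemma cut_ratio_r_less_large_exponent:
  assumes "4 \<le> r" "i \<in> {1..r}" "i < r" "density i < 1 / 2" "3 \<le> t"
  shows "cut_ratio r t < cut_ratio i s"
proof (rule cut_ratio_less)
  have "real (p i) + 1 \<le> real (p r)"
    using p_less[of i r] assms by simp
  have "real r * density r \<le> real (p r) * density r"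
    using p_r_ge assms(1) density_pos[of r] by (intro mult_right_mono) auto
  then have one: "1 \<le> density r * real (p r)"
    using density_r_ge_inverse[OF assms(1)] by (simp add: mult.commute)
  have "(1 - 2 * density r) * (real (p i) - 1) \<le> 1 * real (p r)"
    using density_pos[of r] p_ge_2[OF assms(2)] \<open>real (p i) + 1 \<le> _\<close>
      density_antimono[of i r] assms by (intro mult_mono) auto
  also have "\<dots> \<le> (density r * real (p r)) * (real (p r) * (real (p r) - real (p i)))"
    using one \<open>real (p i) + 1 \<le> _\<close> p_ge_2[OF assms(2)] by (intro mult_mono) auto
  also have "\<dots> = density r * (real (p r) - real (p i)) * real (p r) ^ 2"
    by (simp add: power2_eq_square mult_ac)
  also have "\<dots> \<le> density r * (real (p r) - real (p i)) * real (p r) ^ (t - 1)"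
    using assms(5) density_pos[of r] \<open>real (p i) + 1 \<le> _\<close> p_ge_2[OF assms(2)]
    by (intro mult_left_mono power_increasing mult_nonneg_nonneg) auto
  finally show "(1 - 2 * density r) * (real (p i) - 1)
      \<le> density r * (real (p r) - real (p i)) * real (p r) ^ (t - 1)" .
qed (use assms in auto)

lemma cut_ratio_r_less_gap:
  assumes r: "4 \<le> r" and i: "i \<in> {1..r}" "i < r" "density i < 1 / 2"
    and gap: "real (p i) + real r \<le> real (p r) + 3"
  shows "cut_ratio r 2 < cut_ratio i s"
proof (rule cut_ratio_less)
  let ?d = "density r" and ?P = "real (p i)" and ?R = "real (p r)"
  have d: "0 < ?d" "?d < 1 / 2"
    using density_pos[of r] density_antimono[of i r] i by auto
  have P: "2 \<le> ?P" "?P + 2 \<le> ?R"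
    using p_ge_2[OF i(1)] p_gap[of i r] i r by auto
  have "(1 - 2 * ?d) * (?P - 1) \<le> ?d * (?R - ?P) * ?R"
  proof (cases "r = 5")
    \<comment> \<open>The bound \<open>density r \<ge> 1 / (r - 1)\<close> used for \<open>r \<ge> 6\<close> can fail here (take 2, 3, 5, 7); the
      factor \<open>1 - 1 / p 4\<close> is kept and estimated by \<open>1 - 1 / p i\<close> instead.\<close>
    case True
    have "p i \<le> p 4"
      using p_less[of i 4] i True by (cases "i = 4") auto
    then have "1 - 1 / ?P \<le> 1 - 1 / real (p 4)"
      using P(1) by (simp add: frac_le)
    then have "4 / 15 * (1 - 1 / ?P) \<le> partial_density 3 * (1 - 1 / real (p 4))"
      using partial_density_3 True P(1) by (intro mult_mono) (auto simp: field_simps)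
    also have "\<dots> = ?d"
      using True partial_density_Suc[of 3] density_r[of 4] by simp
    finally have lower: "4 * (?P - 1) \<le> 15 * ?d * ?P"
      using P(1) by (simp add: field_simps)
    have "4 * (?P - 1) * 2 \<le> (15 * ?d * ?P) * 2"
      using lower by simp
    then have "15 * (?P - 1) \<le> 15 * (2 * ?d * (?P + 2) + 2 * ?d * (?P - 1))"
      using d P lower by (simp add: algebra_simps)
    then have "(1 - 2 * ?d) * (?P - 1) \<le> ?d * 2 * (?P + 2)"
      by (simp add: algebra_simps)
    also have "\<dots> \<le> ?d * (?R - ?P) * ?R"
      using d P by (intro mult_mono) auto
    finally show ?thesis .
  next
    case False
    have "1 - 2 * ?d \<le> ?d * (?R - ?P)"
    proof (cases "r = 4")
      case True
      then have "4 / 15 \<le> ?d"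
        using partial_density_3 density_r[of 3] by simp
      then have "1 - 2 * ?d \<le> ?d * 2"
        by simp
      also have "\<dots> \<le> ?d * (?R - ?P)"
        using d P by (intro mult_left_mono) auto
      finally show ?thesis .
    next
      case False
      with r \<open>r \<noteq> 5\<close> have "6 \<le> r"
        by linarith
      then have "1 / real (r - 1) \<le> ?d"
        using partial_density_ge_inverse[of "r - 1"] density_r[of "r - 1"] by simp
      then have "1 - 2 * ?d \<le> ?d * (real r - 3)"
        using \<open>6 \<le> r\<close> by (simp add: field_simps of_nat_diff)
      also have "\<dots> \<le> ?d * (?R - ?P)"
        using gap d by (intro mult_left_mono) auto
      finally show ?thesis .
    qed
    then show ?thesis
      using d P by (intro mult_mono) auto
  qed
  then show "(1 - 2 * ?d) * (?P - 1) \<le> ?d * (?R - ?P) * ?R ^ (2 - 1)"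
    by simp
qed (use assms in auto)

lemma cut_ratio_less_near_r:
  assumes "4 \<le> r" "i \<in> {1..r}" "j \<in> {1..r}" "i < j" "density i < 1 / 2" "3 \<le> t"
    and near: "real (p r) + 4 \<le> real (p j) + real r"
  shows "cut_ratio j t < cut_ratio i s"
proof (rule cut_ratio_less)
  have lt: "real (p i) + 1 \<le> real (p j)"
    using p_less[of i j] assms by simp
  have "real r * density r \<le> real (p j) * density j"
    using p_r_ge assms(1) near density_pos[of r] density_antimono[of j r] assms(3)
    by (intro mult_mono) auto
  then have one: "1 \<le> density j * real (p j)"
    using density_r_ge_inverse[OF assms(1)] by (simp add: mult.commute)
  have "(1 - 2 * density j) * (real (p i) - 1) \<le> 1 * real (p j)"
    using density_pos[of j] p_ge_2[OF assms(2)] lt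
      density_antimono[of i j] assms by (intro mult_mono) auto
  also have "\<dots> \<le> (density j * real (p j)) * (real (p j) * (real (p j) - real (p i)))"
    using one lt p_ge_2[OF assms(2)] by (intro mult_mono) auto
  also have "\<dots> = density j * (real (p j) - real (p i)) * real (p j) ^ 2"
    by (simp add: power2_eq_square mult_ac)
  also have "\<dots> \<le> density j * (real (p j) - real (p i)) * real (p j) ^ (t - 1)"
    using assms(6) density_pos[of j] lt p_ge_2[OF assms(2)]
    by (intro mult_left_mono power_increasing mult_nonneg_nonneg) auto
  finally show "(1 - 2 * density j) * (real (p i) - 1)
      \<le> density j * (real (p j) - real (p i)) * real (p j) ^ (t - 1)" .
qed (use assms in auto)

lemma totient_two_maximal_gt:
  assumes r: "4 \<le> r" and d: "density r < 1 / 2" and t: "2 \<le> t"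
    and ij: "i \<in> {1..r}" "j \<in> {1..r}" "i < j"
  shows "real n * cut_ratio r t < real (totient n + totient (n div p i) + totient (n div p j))"
proof -
  let ?R = "real (p r)"
  have div: "real (totient n) / real (p k) \<le> real (totient (n div p k))" if "k \<in> {1..r}" for k
  proof -
    have "totient n \<le> p k * totient (n div p k)"
      using totient_prime_mult_le[OF prime_p[OF that], of "n div p k"] p_dvd_n[OF that] by simp
    then have "real (totient n) \<le> real (p k) * real (totient (n div p k))"
      by (metis of_nat_le_iff of_nat_mult)
    then show ?thesis
      using p_ge_2[OF that] by (simp add: field_simps)
  qed
  have R: "real r + 1 \<le> ?R + 1" "3 < ?R"
    using p_r_ge r by linarith+
  have pj: "p j \<le> p r" "p i < p j"
    using ij p_less[of j r] p_less[of i j] by (cases "j = r", auto)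
  have "1 < density r * (?R + 1)"
  proof -
    have "1 \<le> real r * density r"
      by (rule density_r_ge_inverse[OF r])
    also have "\<dots> < (?R + 1) * density r"
      using p_r_ge r density_pos[of r] by (intro mult_strict_right_mono) auto
    finally show ?thesis
      by (simp add: mult.commute)
  qed
  have "cut_ratio r t \<le> density r + (1 - 2 * density r) / ?R ^ 2"
  proof -
    have "?R ^ 2 \<le> ?R ^ t"
      using R t by (intro power_increasing) auto
    then show ?thesis
      unfolding cut_ratio_def using d R by (auto intro!: divide_left_mono)
  qed
  also have "\<dots> < density r * (1 - 1 / ?R) * (1 + 1 / ?R + 1 / (?R - 1))"
  proof -
    have eq: "density r * (1 - 1 / ?R) * (1 + 1 / ?R + 1 / (?R - 1))
        - (density r + (1 - 2 * density r) / ?R ^ 2) = (density r * (?R + 1) - 1) / ?R ^ 2"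
      using R by (simp add: divide_simps power2_eq_square) (simp add: algebra_simps)
    have "0 < (density r * (?R + 1) - 1) / ?R ^ 2"
      using R \<open>1 < density r * (?R + 1)\<close> by simp
    then show ?thesis
      unfolding eq[symmetric] by simp
  qed
  also have "\<dots> \<le> density r * (1 - 1 / ?R) * (1 + 1 / real (p i) + 1 / real (p j))"
  proof -
    have "1 / ?R \<le> 1 / real (p j)" "1 / (?R - 1) \<le> 1 / real (p i)"
      using pj p_ge_2[OF ij(1)] p_ge_2[OF ij(2)] by (auto intro!: frac_le)
    then show ?thesis
      using density_pos[of r] R by (intro mult_left_mono mult_nonneg_nonneg) auto
  qed
  finally have "real n * cut_ratio r t
      < real n * (density r * (1 - 1 / ?R) * (1 + 1 / real (p i) + 1 / real (p j)))"
    using n_pos by (intro mult_strict_left_mono) auto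
  also have "\<dots> = real (totient n) + real (totient n) / real (p i) + real (totient n) / real (p j)"
  proof -
    have "m * (c * (1 + 1 / a + 1 / b)) = m * c + m * c / a + m * c / b" for m c a b :: real
      by (simp add: algebra_simps)
    moreover have "real (totient n) = real n * (density r * (1 - 1 / ?R))"
      using totient_n[of r] r by simp
    ultimately show ?thesis
      by simp
  qed
  also have "\<dots> \<le> real (totient n + totient (n div p i) + totient (n div p j))"
    using div[OF ij(1)] div[OF ij(2)] by simp
  finally show ?thesis .
qed

end

section \<open>Minimum cut-sets\<close>

locale cyclic_group_prime_powers = group G + prime_power_product n r p e
  for G (structure) and n r :: nat and p e :: "nat \<Rightarrow> nat" +
  assumes cyclic: "cyclic_group G" and order_G: "order G = n"
begin

lemma finite_G: "finite (carrier G)"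
  using n_pos order_G order_gt_0_iff_finite by simp

lemma card_carrier: "card (carrier G) = n"
  using order_G by (simp add: order_def)

lemma ord_dvd_n: "x \<in> carrier G \<Longrightarrow> ord x dvd n"
  using ord_dvd_group_order order_G by metis

lemma card_ord: "card {x \<in> carrier G. P (ord x)} = (\<Sum>d | d dvd n \<and> P d. totient d)"
  using card_ord_cyclic[OF cyclic finite_G] order_G by simp

lemma ex_ord:
  assumes "d dvd n"
  obtains x where "x \<in> carrier G" "ord x = d"
proof -
  have "card (elems_of_order G d) > 0"
    using card_elems_of_order_cyclic[OF cyclic finite_G] assms order_G n_pos
    by (simp add: dvd_pos_nat)
  then have "elems_of_order G d \<noteq> {}"
    by auto
  then show thesis
    using that by (auto simp: elems_of_order_def)
qed

definition below :: "'a set \<Rightarrow> 'a set" where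
  "below A = {x \<in> carrier G. \<exists>a\<in>A. ord x dvd ord a}"

definition above :: "'a set \<Rightarrow> 'a set" where
  "above A = {x \<in> carrier G. \<exists>a\<in>A. ord a dvd ord x}"

definition separation :: "'a set \<Rightarrow> 'a set \<Rightarrow> bool" where
  "separation A B \<longleftrightarrow> A \<noteq> {} \<and> B \<noteq> {} \<and> A \<subseteq> carrier G \<and> B \<subseteq> carrier G \<and> A \<inter> B = {} \<and>
     (\<forall>a\<in>A. \<forall>b\<in>B. \<not> ord a dvd ord b \<and> \<not> ord b dvd ord a)"

lemma cut_set_iff:
  "cut_set (power_graph G) X \<longleftrightarrow> X \<subseteq> carrier G \<and> (\<exists>A B. separation A B \<and> A \<union> B = carrier G - X)"
proof -
  have "A \<noteq> {} \<and> B \<noteq> {} \<and> A \<inter> B = {} \<and> A \<union> B = carrier G - X \<and>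
      (\<forall>a\<in>A. \<forall>b\<in>B. \<not> ord a dvd ord b \<and> \<not> ord b dvd ord a)
    \<longleftrightarrow> separation A B \<and> A \<union> B = carrier G - X" for A B
    unfolding separation_def by blast
  then show ?thesis
    unfolding cut_set_power_graph_iff[OF cyclic finite_G] by simp
qed

lemma Zset_conv:
  assumes i: "i \<in> {1..r}" and s: "1 \<le> s" "s \<le> e i"
  shows "Zset G n r p i s =
    {x \<in> carrier G. cofactor i dvd ord x \<longleftrightarrow> \<not> ord x dvd cofactor i * p i ^ (e i - s)}"
proof -
  let ?c = "cofactor i"
  have Q: "x \<in> Qset G n r p i s \<longleftrightarrow> ord x dvd ?c * p i ^ (e i - s) \<and> \<not> ?c dvd ord x"
    if x: "x \<in> carrier G" for x
  proof -
    have "x \<in> Qset G n r p i s \<longleftrightarrow> (\<exists>k \<in> {1..r} - {i}. ord x dvd ?c div p k * p i ^ (e i - s))"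
      using x n_div_primes[OF i s(2)] by (auto simp: Qset_def elems_of_order_dvd_def)
    also have "\<dots> \<longleftrightarrow> ord x dvd ?c * p i ^ (e i - s) \<and> \<not> ?c dvd ord x"
    proof -
      have "ord x dvd ?c * p i ^ (e i - s)"
        if "k \<in> {1..r} - {i}" "ord x dvd ?c div p k * p i ^ (e i - s)" for k
      proof -
        have "?c div p k dvd ?c"
          using p_dvd_cofactor[OF that(1)] by (metis dvd_mult_div_cancel dvd_triv_right)
        then show ?thesis
          by (rule dvd_trans[OF that(2) mult_dvd_mono[OF _ dvd_refl]])
      qed
      then show ?thesis
        using cofactor_dvd_iff[OF i] by blast
    qed
    finally show ?thesis .
  qed
  have E: "(\<exists>j\<in>{0..<s}. ord x = n div p i ^ j) \<longleftrightarrow>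
      ?c dvd ord x \<and> \<not> ord x dvd ?c * p i ^ (e i - s)" if x: "x \<in> carrier G" for x
  proof
    assume "\<exists>j\<in>{0..<s}. ord x = n div p i ^ j"
    then obtain j where j: "j < s" "ord x = ?c * p i ^ (e i - j)"
      using n_div_prime_power[OF i] s(2) by auto
    have "\<not> p i ^ (e i - j) dvd p i ^ (e i - s)"
      using j(1) s(2) p_ge_2[OF i] by (subst dvd_power_iff_le) auto
    then show "?c dvd ord x \<and> \<not> ord x dvd ?c * p i ^ (e i - s)"
      using j(2) cofactor_pos[of i] by simp
  next
    assume c: "?c dvd ord x \<and> \<not> ord x dvd ?c * p i ^ (e i - s)"
    then obtain t where t: "t \<le> e i" "ord x = ?c * p i ^ t"
      using between_cofactor[OF i] ord_dvd_n[OF x] n_eq_cofactor[OF i] by metis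
    then have "\<not> p i ^ t dvd p i ^ (e i - s)"
      using c by (metis dvd_refl mult_dvd_mono)
    then have "e i - t < s"
      using t(1) le_imp_power_dvd[of t "e i - s" "p i"] by linarith
    moreover have "ord x = n div p i ^ (e i - t)"
      using t n_div_prime_power[OF i, of "e i - t"] by simp
    ultimately show "\<exists>j\<in>{0..<s}. ord x = n div p i ^ j"
      by auto
  qed
  have sub: "Zset G n r p i s \<subseteq> carrier G"
    by (auto simp: Zset_def Qset_def elems_of_order_def elems_of_order_dvd_def)
  have Z: "x \<in> Zset G n r p i s \<longleftrightarrow>
      (\<exists>j\<in>{0..<s}. ord x = n div p i ^ j) \<or> x \<in> Qset G n r p i s" if "x \<in> carrier G" for x
    using that by (auto simp: Zset_def elems_of_order_def)
  show ?thesis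
  proof (rule Set.set_eqI)
    fix x
    show "x \<in> Zset G n r p i s \<longleftrightarrow>
        x \<in> {x \<in> carrier G. ?c dvd ord x \<longleftrightarrow> \<not> ord x dvd ?c * p i ^ (e i - s)}"
      using sub Z[of x] Q[of x] E[of x] by (cases "x \<in> carrier G") auto
  qed
qed

lemma card_ord_dvd: "m dvd n \<Longrightarrow> card {x \<in> carrier G. ord x dvd m} = m"
proof -
  assume "m dvd n"
  then have "{d. d dvd n \<and> d dvd m} = {d. d dvd m}"
    by (auto intro: dvd_trans)
  then show ?thesis
    using card_ord[of "\<lambda>d. d dvd m"] by (simp add: totient_divisor_sum)
qed

lemma card_Zset:
  assumes i: "i \<in> {1..r}" and s: "1 \<le> s" "s \<le> e i"
  shows "real (card (Zset G n r p i s)) = n * cut_ratio i s"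
proof -
  let ?c = "cofactor i"
  let ?m = "?c * p i ^ (e i - s)"
  let ?C = "{x \<in> carrier G. ?c dvd ord x}" and ?S = "{x \<in> carrier G. ord x dvd ?m}"
  have n: "n = ?c * p i ^ e i"
    by (rule n_eq_cofactor[OF i])
  have m: "?m dvd n"
    using n s by (auto intro: mult_dvd_mono le_imp_power_dvd)
  have "{d. d dvd n \<and> ?c dvd d} = {d. ?c dvd d \<and> d dvd ?c * p i ^ e i}"
    using n by auto
  then have C: "card ?C = totient ?c * p i ^ e i"
    using sum_totient_multiples[OF coprime_cofactor[OF i] cofactor_pos]
      card_ord[of "\<lambda>d. ?c dvd d"] by simp
  have "{d. d dvd n \<and> ?c dvd d \<and> d dvd ?m} = {d. ?c dvd d \<and> d dvd ?m}"
    using m by (auto intro: dvd_trans[OF _ m])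
  then have CS: "card {x \<in> carrier G. ?c dvd ord x \<and> ord x dvd ?m} = totient ?c * p i ^ (e i - s)"
    using sum_totient_multiples[OF coprime_cofactor[OF i] cofactor_pos]
      card_ord[of "\<lambda>d. ?c dvd d \<and> d dvd ?m"] by simp
  have U: "Zset G n r p i s \<union> {x \<in> carrier G. ?c dvd ord x \<and> ord x dvd ?m} = ?C \<union> ?S"
    unfolding Zset_conv[OF assms] by blast
  have "card (?C \<union> ?S) + card {x \<in> carrier G. ?c dvd ord x \<and> ord x dvd ?m} = card ?C + card ?S"
  proof -
    have "?C \<inter> ?S = {x \<in> carrier G. ?c dvd ord x \<and> ord x dvd ?m}"
      by blast
    then show ?thesis
      using card_Un_Int[of ?C ?S] finite_G by simp
  qed
  moreover have "card (Zset G n r p i s \<union> {x \<in> carrier G. ?c dvd ord x \<and> ord x dvd ?m})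
      = card (Zset G n r p i s) + card {x \<in> carrier G. ?c dvd ord x \<and> ord x dvd ?m}"
    unfolding Zset_conv[OF assms] using finite_G by (intro card_Un_disjoint) auto
  ultimately have "card (Zset G n r p i s) + card {x \<in> carrier G. ?c dvd ord x \<and> ord x dvd ?m}
      + card {x \<in> carrier G. ?c dvd ord x \<and> ord x dvd ?m} = card ?C + card ?S"
    unfolding U by linarith
  then have "card (Zset G n r p i s) + 2 * (totient ?c * p i ^ (e i - s)) = totient ?c * p i ^ e i + ?m"
    unfolding CS C card_ord_dvd[OF m] by simp
  then have "real (card (Zset G n r p i s)) + 2 * (real (totient ?c) * real (p i ^ (e i - s)))
      = real (totient ?c) * real (p i ^ e i) + real ?m"
    by (metis of_nat_add of_nat_mult of_nat_numeral)
  moreover have "real (p i ^ e i) = real (p i ^ (e i - s)) * real (p i ^ s)"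
    using s by (simp flip: power_add)
  moreover have "real (p i ^ s) > 0"
    using p_ge_2[OF i] by simp
  moreover have "real n = real ?c * real (p i ^ e i)"
    using n by (metis of_nat_mult)
  moreover have "z = m * (d + (1 - 2 * d) / u)"
    if "z + 2 * (c * d * v) = c * d * q + c * v" "q = v * u" "0 < u" "m = c * q"
    for z m d u c v q :: real
  proof -
    have "z = c * d * (v * u) + c * v - 2 * (c * d * v)"
      using that(1,2) by simp
    moreover have "c * (v * u) * (d + (1 - 2 * d) / u) = c * d * (v * u) + c * v - 2 * (c * d * v)"
      using that(3) by (simp add: field_simps)
    ultimately show ?thesis
      using that(2,4) by simp
  qed
  ultimately show ?thesis
    unfolding cut_ratio_def totient_cofactor of_nat_mult by metis
qed

lemma cut_set_Zset:
  assumes r: "2 \<le> r" and i: "i \<in> {1..r}" and s: "1 \<le> s" "s \<le> e i"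
  shows "cut_set (power_graph G) (Zset G n r p i s)"
proof -
  let ?c = "cofactor i"
  let ?m = "?c * p i ^ (e i - s)"
  let ?A = "{x \<in> carrier G. ?c dvd ord x \<and> ord x dvd ?m}"
  let ?B = "{x \<in> carrier G. \<not> ?c dvd ord x \<and> \<not> ord x dvd ?m}"
  have n: "n = ?c * p i ^ e i"
    by (rule n_eq_cofactor[OF i])
  obtain a where a: "a \<in> carrier G" "ord a = ?c"
    using ex_ord[of ?c] n by auto
  obtain b where b: "b \<in> carrier G" "ord b = p i ^ e i"
    using ex_ord[of "p i ^ e i"] n by auto
  obtain k where k: "k \<in> {1..r} - {i}"
    using that[of 1] that[of 2] r by (cases "i = 1") auto
  have "?c \<noteq> 1"
    using p_dvd_cofactor[OF k] p_ge_2[of k] k by auto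
  then have "\<not> ?c dvd p i ^ e i"
    using coprime_cofactor[OF i, of "e i"] by (metis coprime_absorb_left nat_dvd_1_iff_1)
  moreover have "\<not> p i ^ e i dvd ?m"
  proof -
    have "\<not> p i ^ e i dvd p i ^ (e i - s)"
      using s p_ge_2[OF i] by (subst dvd_power_iff_le) auto
    then show ?thesis
      using coprime_cofactor[OF i, of "e i"] by (simp add: coprime_commute coprime_dvd_mult_right_iff)
  qed
  ultimately have "b \<in> ?B"
    using b by simp
  moreover have "a \<in> ?A"
    using a by simp
  moreover have "\<not> ord a dvd ord b \<and> \<not> ord b dvd ord a" if "a \<in> ?A" "b \<in> ?B" for a b
    using that dvd_trans[of ?c "ord a" "ord b"] dvd_trans[of "ord b" "ord a" ?m] by blast
  moreover have "?A \<inter> ?B = {}"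
    by blast
  moreover have part: "?A \<union> ?B = carrier G - Zset G n r p i s"
    unfolding Zset_conv[OF i s] by blast
  moreover have sub: "Zset G n r p i s \<subseteq> carrier G"
    unfolding Zset_conv[OF i s] by blast
  ultimately have "separation ?A ?B"
    unfolding separation_def by blast
  then show ?thesis
    using part sub unfolding cut_set_iff by blast
qed

lemma separation_sym: "separation A B \<longleftrightarrow> separation B A"
  unfolding separation_def by blast

lemma min_cut_set_separation:
  assumes "min_cut_set (power_graph G) X"
  obtains A B where "separation A B" "A \<union> B = carrier G - X"
    "X = (below A \<inter> below B) \<union> (above A \<inter> above B)"
proof -
  have cut: "cut_set (power_graph G) X"
    using assms by (simp add: min_cut_set_def)
  then obtain A B where AB: "separation A B" "A \<union> B = carrier G - X" and X: "X \<subseteq> carrier G"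
    unfolding cut_set_iff by blast
  have BA: "separation B A" "B \<union> A = carrier G - X"
    using AB by (simp_all add: Un_commute flip: separation_sym)
  have nbr: "\<exists>c\<in>C. ord c dvd ord x \<or> ord x dvd ord c"
    if x: "x \<in> X" and CD: "separation C D" "C \<union> D = carrier G - X" for x C D
  proof (rule ccontr)
    assume nex: "\<not> ?thesis"
    have "x \<notin> C" "x \<in> carrier G"
      using x CD(2) X by blast+
    then have "separation C (insert x D)"
      using nex CD(1) unfolding separation_def by simp
    moreover have "C \<union> insert x D = carrier G - (X - {x})" "X - {x} \<subseteq> carrier G"
      using x CD(2) X by blast+
    ultimately have "cut_set (power_graph G) (X - {x})"
      unfolding cut_set_iff by blast
    then have "card X \<le> card (X - {x})"
      using assms by (simp add: min_cut_set_def)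
    then show False
      using x X finite_G by (meson card_Diff1_less finite_subset leD)
  qed
  have "X \<subseteq> (below A \<inter> below B) \<union> (above A \<inter> above B)"
  proof
    fix x assume x: "x \<in> X"
    obtain a where a: "a \<in> A" "ord a dvd ord x \<or> ord x dvd ord a"
      using nbr[OF x AB] by blast
    obtain b where b: "b \<in> B" "ord b dvd ord x \<or> ord x dvd ord b"
      using nbr[OF x BA] by blast
    have "\<not> ord a dvd ord b" "\<not> ord b dvd ord a"
      using AB(1) a(1) b(1) unfolding separation_def by blast+
    then have "\<not> (ord a dvd ord x \<and> ord x dvd ord b)" "\<not> (ord b dvd ord x \<and> ord x dvd ord a)"
      by (meson dvd_trans)+
    then show "x \<in> (below A \<inter> below B) \<union> (above A \<inter> above B)"
      using a b x X unfolding below_def above_def by blast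
  qed
  moreover have "(below A \<inter> below B) \<union> (above A \<inter> above B) \<subseteq> X"
  proof
    fix x assume "x \<in> (below A \<inter> below B) \<union> (above A \<inter> above B)"
    then have "x \<in> carrier G" "x \<notin> A" "x \<notin> B"
      using AB(1) unfolding below_def above_def separation_def by blast+
    then show "x \<in> X"
      using AB(2) by blast
  qed
  ultimately show thesis
    using that[OF AB] by (meson subset_antisym)
qed

lemma card_below_correlation: "card (below A) * card (below B) \<le> n * card (below A \<inter> below B)"
proof -
  let ?P = "\<lambda>C d. \<exists>c\<in>C. d dvd ord c"
  have "below A \<inter> below B = {x \<in> carrier G. ?P A (ord x) \<and> ?P B (ord x)}"
    unfolding below_def by blast
  then have "card (below A \<inter> below B) = (\<Sum>d | d dvd n \<and> ?P A d \<and> ?P B d. totient d)"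
    using card_ord[of "\<lambda>d. ?P A d \<and> ?P B d"] by simp
  moreover have "card (below C) = (\<Sum>d | d dvd n \<and> ?P C d. totient d)" for C
    unfolding below_def using card_ord[of "?P C"] by simp
  moreover have "?P C a" if "a dvd b" "?P C b" for C a b
    using that by (meson dvd_trans)
  ultimately show ?thesis
    using downward_closed_divisors_correlation[OF n_pos, of "?P A" "?P B"] by simp
qed

lemma card_above_le:
  assumes sep: "separation A B" "A \<union> B = carrier G - X"
    and X: "X = (below A \<inter> below B) \<union> (above A \<inter> above B)"
    and small: "2 * card X < n" and le: "card (below A) \<le> card (below B)"
  shows "card (above A) \<le> card X"
proof -
  let ?l = "card (below A \<inter> below B)" and ?u = "card (above A \<inter> above B)"
  let ?a = "card (below A)" and ?b = "card (below B)"
  have fin: "finite (below C)" "finite (above C)" for C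
    using finite_G by (simp_all add: below_def above_def)
  have sub: "below A \<subseteq> carrier G" "below B \<subseteq> carrier G" "above A \<subseteq> carrier G" "above B \<subseteq> carrier G"
    by (auto simp: below_def above_def)
  have disj: "below A \<inter> above B = {}" "below B \<inter> above A = {}"
  proof -
    have "False" if "x \<in> below C" "x \<in> above D" "\<forall>c\<in>C. \<forall>d\<in>D. \<not> ord d dvd ord c" for x C D
      using that unfolding below_def above_def by (auto dest: dvd_trans)
    then show "below A \<inter> above B = {}" "below B \<inter> above A = {}"
      using sep(1) unfolding separation_def by blast+
  qed
  have in_below: "C \<subseteq> below C" if "C \<subseteq> carrier G" for C
    using that dvd_refl unfolding below_def by blast
  have "A \<subseteq> below A" "B \<subseteq> below B"
    using sep(1) in_below unfolding separation_def by blast+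
  then have carrier: "carrier G = (below A \<union> below B) \<union> (above A \<inter> above B)"
  proof (intro equalityI subsetI)
    fix x assume "x \<in> carrier G"
    then show "x \<in> (below A \<union> below B) \<union> (above A \<inter> above B)"
      using sep(2) \<open>A \<subseteq> below A\<close> \<open>B \<subseteq> below B\<close> X by (cases "x \<in> X") blast+
  qed (use sub in blast)
  have "n = card (below A \<union> below B) + ?u"
    unfolding card_carrier[symmetric] carrier using disj fin by (intro card_Un_disjoint) auto
  moreover have "card (below A \<union> below B) + ?l = ?a + ?b"
    using card_Un_Int[OF fin(1) fin(1)] by simp
  ultimately have n: "n + ?l = ?a + ?b + ?u"
    by linarith
  have cX: "card X = ?l + ?u"
    unfolding X using disj fin by (intro card_Un_disjoint) auto
  have "card (above A) + ?b \<le> n"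
  proof -
    have "card (above A) + ?b = card (above A \<union> below B)"
      using disj fin by (subst card_Un_disjoint) auto
    also have "\<dots> \<le> n"
      unfolding card_carrier[symmetric] using sub finite_G by (intro card_mono) auto
    finally show ?thesis .
  qed
  moreover have "?a \<le> 2 * ?l"
  proof (cases "n \<le> 2 * ?b")
    case True
    have "n * ?a \<le> 2 * (?a * ?b)"
      using mult_right_mono[OF True, of ?a] by (simp add: mult_ac)
    also have "\<dots> \<le> n * (2 * ?l)"
      using card_below_correlation[of A B] by simp
    finally show ?thesis
      using n_pos by simp
  next
    case False
    have corr: "real ?a * real ?b \<le> real n * real ?l"
      using card_below_correlation[of A B] by (metis of_nat_le_iff of_nat_mult)
    have "0 \<le> (real n - 2 * ?a) * (real n - 2 * ?b)"
      using False le by (intro mult_nonneg_nonneg) auto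
    then have "real n * (2 * (real ?a + real ?b)) \<le> real n * (real n + 4 * real ?l)"
      using corr by (simp add: algebra_simps)
    then have "2 * (real ?a + real ?b) \<le> real n + 4 * real ?l"
      using n_pos by (simp add: mult_le_cancel_left_pos)
    then have "real (2 * (?a + ?b)) \<le> real (n + 4 * ?l)"
      by simp
    then have "2 * (?a + ?b) \<le> n + 4 * ?l"
      by (simp only: of_nat_le_iff)
    moreover have "2 * n + 2 * ?l = 2 * (?a + ?b) + 2 * ?u"
      using n by simp
    ultimately have "n \<le> 2 * (?l + ?u)"
      by simp
    then show ?thesis
      using small cX by simp
  qed
  ultimately show ?thesis
    using n cX by simp
qed

lemma min_cut_set_one_sided:
  assumes min: "min_cut_set (power_graph G) X" and sep: "separation A B" "A \<union> B = carrier G - X"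
    and r: "2 \<le> r"
    and few: "card (above A) \<le> card X"
    and many: "\<And>i j. i \<in> {1..r} \<Longrightarrow> j \<in> {1..r} \<Longrightarrow> i < j \<Longrightarrow>
        card X < totient n + totient (n div p i) + totient (n div p j)"
  obtains i s where "i \<in> {1..r}" "1 \<le> s" "s \<le> e i" "X = Zset G n r p i s"
proof -
  define J where "J = {i \<in> {1..r}. \<exists>a\<in>A. ord a dvd n div p i}"
  have A: "A \<subseteq> carrier G" "A \<noteq> {}"
    using sep(1) by (auto simp: separation_def)
  have ord_ne_n: "ord a \<noteq> n" if "a \<in> A" for a
    using that sep(1) ord_dvd_n unfolding separation_def by (metis all_not_in_conv subsetD)
  have no_two: False if ij: "i \<in> J" "j \<in> J" "i < j" for i j
  proof -
    have i: "i \<in> {1..r}" "p i dvd n" "2 \<le> p i" and j: "j \<in> {1..r}" "p j dvd n" "2 \<le> p j"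
      using ij p_dvd_n p_ge_2 unfolding J_def by auto
    have "p i < p j"
      using p_less i j ij by blast
    have dist: "n div p i \<noteq> n div p j" "n div p i \<noteq> n" "n div p j \<noteq> n"
      using \<open>p i < p j\<close> i j n_pos by (auto simp: dvd_div_eq_mult)
    have sub: "elems_of_order G d \<subseteq> above A" if "d dvd n" "a \<in> A" "ord a dvd d" for a d
      using that unfolding elems_of_order_def above_def by blast
    have "elems_of_order G n \<union> elems_of_order G (n div p i) \<union> elems_of_order G (n div p j) \<subseteq> above A"
    proof -
      have "n div p i dvd n" "n div p j dvd n"
        using i j by (simp_all add: div_dvd_iff_mult)
      moreover obtain a b where "a \<in> A" "ord a dvd n div p i" "b \<in> A" "ord b dvd n div p j"
        using ij unfolding J_def by blast
      moreover have "ord a dvd n"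
        using \<open>a \<in> A\<close> A ord_dvd_n by blast
      ultimately show ?thesis
        by (intro Un_least sub[of n] sub[of "n div p i"] sub[of "n div p j"]) simp_all
    qed
    then have "card (elems_of_order G n \<union> elems_of_order G (n div p i) \<union> elems_of_order G (n div p j))
        \<le> card (above A)"
      using finite_G by (intro card_mono) (auto simp: above_def)
    moreover have "card (elems_of_order G n \<union> elems_of_order G (n div p i) \<union> elems_of_order G (n div p j))
        = totient n + totient (n div p i) + totient (n div p j)"
    proof -
      have "card (elems_of_order G d) = totient d" if "d dvd n" for d
        using card_elems_of_order_cyclic[OF cyclic finite_G] that order_G by simp
      moreover have "n div p i dvd n" "n div p j dvd n"
        using i j by (simp_all add: div_dvd_iff_mult)
      ultimately show ?thesis
        using dist finite_G
        by (subst card_Un_disjoint, (auto simp: elems_of_order_def)[3])+ (auto simp: elems_of_order_def)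
    qed
    ultimately show False
      using many[OF i(1) j(1) ij(3)] few by linarith
  qed
  obtain a0 where a0: "a0 \<in> A"
    using A by blast
  obtain i where i: "i \<in> {1..r}" "ord a0 dvd n div p i"
    using dvd_maximal_divisor[OF ord_dvd_n ord_ne_n[OF a0]] a0 A by blast
  then have iJ: "i \<in> J"
    using a0 unfolding J_def by blast
  let ?c = "cofactor i"
  have n: "n = ?c * p i ^ e i"
    by (rule n_eq_cofactor[OF i(1)])
  have c_dvd: "?c dvd ord a" if a: "a \<in> A" for a
  proof (rule ccontr)
    assume nd: "\<not> ?c dvd ord a"
    have "ord a dvd ?c * p i ^ e i"
      using a A ord_dvd_n n by auto
    then obtain k where k: "k \<in> {1..r} - {i}" "ord a dvd ?c div p k * p i ^ e i"
      using nd cofactor_dvd_iff[OF i(1)] by blast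
    have "?c div p k * p i ^ e i = n div p k"
      using n_div_primes[OF i(1) _ k(1), of 0] by simp
    then have "k \<in> J"
      using k a unfolding J_def by auto
    then show False
      using no_two iJ k(1) by (metis DiffD2 insertI1 nat_neq_iff)
  qed
  have "\<exists>t. ord a = ?c * p i ^ t \<and> t < e i" if a: "a \<in> A" for a
  proof -
    obtain t where t: "t \<le> e i" "ord a = ?c * p i ^ t"
      using between_cofactor[OF i(1) c_dvd[OF a]] ord_dvd_n a A n by (metis subsetD)
    then show ?thesis
      using ord_ne_n[OF a] n le_neq_implies_less by metis
  qed
  then obtain t where t: "\<And>a. a \<in> A \<Longrightarrow> ord a = ?c * p i ^ t a" "\<And>a. a \<in> A \<Longrightarrow> t a < e i"
    by metis
  have finA: "finite A"
    using A finite_G finite_subset by blast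
  define m where "m = Max (t ` A)"
  have "m \<in> t ` A"
    unfolding m_def using finA A by (intro Max_in) auto
  then obtain a1 where a1: "a1 \<in> A" "t a1 = m"
    by blast
  define s where "s = e i - m"
  have s: "1 \<le> s" "s \<le> e i" "e i - s = m"
    using a1 t(2)[OF a1(1)] unfolding s_def by auto
  have ord_a1: "ord a1 = ?c * p i ^ (e i - s)"
    using a1 t(1) s(3) by simp
  have le_a1: "ord a dvd ord a1" if "a \<in> A" for a
    using t(1)[OF that] ord_a1 s(3) finA that unfolding m_def
    by (auto intro!: mult_dvd_mono le_imp_power_dvd)
  have "Zset G n r p i s \<subseteq> X"
  proof
    fix x assume "x \<in> Zset G n r p i s"
    then have x: "x \<in> carrier G" "?c dvd ord x \<longleftrightarrow> \<not> ord x dvd ord a1"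
      unfolding Zset_conv[OF i(1) s(1,2)] ord_a1 by auto
    have "ord a1 dvd ord x \<or> ord x dvd ord a1"
    proof (cases "ord x dvd ord a1")
      case False
      then have "?c dvd ord x"
        using x(2) by simp
      then obtain k where k: "ord x = ?c * p i ^ k"
        using between_cofactor[OF i(1)] ord_dvd_n[OF x(1)] n by metis
      show ?thesis
        unfolding k ord_a1 using nat_le_linear[of k "e i - s"]
        by (auto intro!: mult_dvd_mono le_imp_power_dvd)
    qed simp
    then have "x \<notin> B"
      using a1(1) sep(1) unfolding separation_def by blast
    moreover have "x \<notin> A"
      using x(2) c_dvd le_a1 by blast
    ultimately show "x \<in> X"
      using x(1) sep(2) by blast
  qed
  moreover have "finite X" "card X \<le> card (Zset G n r p i s)"
  proof -
    show "card X \<le> card (Zset G n r p i s)"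
      using min cut_set_Zset[OF r i(1) s(1,2)] by (simp add: min_cut_set_def)
    have "X \<subseteq> carrier G"
      using min unfolding min_cut_set_def cut_set_iff by blast
    then show "finite X"
      using finite_G finite_subset by blast
  qed
  ultimately have "X = Zset G n r p i s"
    by (metis card_seteq)
  then show thesis
    using that i(1) s by blast
qed

lemma min_cut_set_eq_Zset:
  assumes min: "min_cut_set (power_graph G) X" and r: "2 \<le> r" and small: "2 * card X < n"
    and many: "\<And>i j. i \<in> {1..r} \<Longrightarrow> j \<in> {1..r} \<Longrightarrow> i < j \<Longrightarrow>
        card X < totient n + totient (n div p i) + totient (n div p j)"
  obtains i s where "i \<in> {1..r}" "1 \<le> s" "s \<le> e i" "X = Zset G n r p i s"
proof -
  obtain A B where AB: "separation A B" "A \<union> B = carrier G - X"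
    and X: "X = (below A \<inter> below B) \<union> (above A \<inter> above B)"
    using min_cut_set_separation[OF min] .
  have BA: "separation B A" "B \<union> A = carrier G - X"
    and X': "X = (below B \<inter> below A) \<union> (above B \<inter> above A)"
  proof -
    show "separation B A" "B \<union> A = carrier G - X"
      using AB by (simp_all add: Un_commute flip: separation_sym)
    show "X = (below B \<inter> below A) \<union> (above B \<inter> above A)"
      by (subst X) (simp add: Int_commute)
  qed
  consider "card (above A) \<le> card X" | "card (above B) \<le> card X"
    using card_above_le[OF AB X small] card_above_le[OF BA X' small] nat_le_linear by blast
  then show thesis
    using min_cut_set_one_sided[OF min AB r _ many] min_cut_set_one_sided[OF min BA r _ many] that
    by cases blast+
qed

lemma min_cut_set_classification:
  assumes r: "4 \<le> r" and er: "2 \<le> e r" and d: "density r < 1 / 2"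
    and min: "min_cut_set (power_graph G) X"
  obtains "X = Zset G n r p r (e r)"
  | b where "e r = 2" "Omega r p e \<noteq> {}" "b = Max (Omega r p e)" "b \<in> {1..r}" "X = Zset G n r p b (e b)"
proof -
  have r_in: "r \<in> {1..r}"
    using r by simp
  have le: "card X \<le> card (Zset G n r p i s)" if "i \<in> {1..r}" "1 \<le> s" "s \<le> e i" for i s
    using min cut_set_Zset[OF _ that] r by (simp add: min_cut_set_def)
  have "real (card X) \<le> real (card (Zset G n r p r (e r)))"
    using le[OF r_in, of "e r"] er by simp
  then have X_le: "real (card X) \<le> n * cut_ratio r (e r)"
    using card_Zset[OF r_in] er by simp
  also have "\<dots> < n * (1 / 2)"
    using cut_ratio_less_half[OF r_in d er] n_pos by (intro mult_strict_left_mono) auto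
  finally have small: "2 * card X < n"
    by linarith
  have many: "card X < totient n + totient (n div p i) + totient (n div p j)"
    if "i \<in> {1..r}" "j \<in> {1..r}" "i < j" for i j
    using le_less_trans[OF X_le totient_two_maximal_gt[OF r d er that]] by (simp only: of_nat_less_iff)
  obtain i s where i: "i \<in> {1..r}" "1 \<le> s" "s \<le> e i" and X: "X = Zset G n r p i s"
    using min_cut_set_eq_Zset[OF min _ small many] r by auto
  have ratio_le: "cut_ratio i s \<le> cut_ratio j t" if "j \<in> {1..r}" "1 \<le> t" "t \<le> e j" for j t
  proof -
    have "n * cut_ratio i s \<le> n * cut_ratio j t"
      using le[OF that] card_Zset[OF i] card_Zset[OF that] X by (metis of_nat_le_iff)
    then show ?thesis
      using n_pos by simp
  qed
  have di: "density i < 1 / 2"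
    using cut_ratio_ge_half[OF i(1) _ i(2)] cut_ratio_less_half[OF r_in d er]
      ratio_le[OF r_in, of "e r"] er by linarith
  have s: "s = e i"
    using cut_ratio_antimono_exponent[OF i(1) di, of s "e i"] ratio_le[OF i(1), of "e i"] i
    by linarith
  show thesis
  proof (cases "i = r")
    case True
    then show ?thesis
      using that(1) X s by simp
  next
    case False
    then have "i < r"
      using i(1) by simp
    have not_less: "\<not> cut_ratio r (e r) < cut_ratio i s"
      using ratio_le[OF r_in, of "e r"] er by simp
    have "\<not> 3 \<le> e r"
      using not_less cut_ratio_r_less_large_exponent[OF r i(1) \<open>i < r\<close> di] by blast
    then have e2: "e r = 2"
      using er by linarith
    have "\<not> s \<le> 2"
      using not_less cut_ratio_r_less_small_exponent[OF i(1) \<open>i < r\<close> di i(2)] unfolding e2 by blast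
    then have "3 \<le> e i"
      using s by simp
    moreover have "\<not> real (p i) + real r \<le> real (p r) + 3"
      using not_less cut_ratio_r_less_gap[OF r i(1) \<open>i < r\<close> di] e2 by metis
    then have "int (p r) - int (p i) \<le> int r - 4"
      by linarith
    ultimately have iO: "i \<in> Omega r p e"
      using totient_prod_p_div_less_iff[OF i(1)] di i(1) \<open>i < r\<close> by (simp add: Omega_def)
    define b where "b = Max (Omega r p e)"
    have fin: "finite (Omega r p e)"
      by (simp add: Omega_def)
    have bO: "b \<in> Omega r p e" and "i \<le> b"
      unfolding b_def using fin iO by (auto intro: Max_in)
    have b: "b \<in> {1..r}" "3 \<le> e b" "real (p r) + 4 \<le> real (p b) + real r"
      using bO by (auto simp: Omega_def)
    have "i = b"
    proof (rule ccontr)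
      assume "i \<noteq> b"
      then have "cut_ratio b (e b) < cut_ratio i s"
        using \<open>i \<le> b\<close> by (intro cut_ratio_less_near_r[OF r i(1) b(1) _ di b(2,3)]) auto
      then show False
        using ratio_le[OF b(1), of "e b"] b(2) by simp
    qed
    then show ?thesis
      using that(2)[OF e2 _ b_def b(1)] iO X s by blast
  qed
qed

end

theorem theorem1p2:
  fixes G :: "'a monoid" and n r :: nat and p e :: "nat \<Rightarrow> nat" and X :: "'a set"
  assumes "group G" and "cyclic_group G" and "order G = n"
    and "n = (\<Prod>i=1..r. p i ^ e i)"
    and "\<And>i. i \<in> {1..r} \<Longrightarrow> prime (p i)"
    and "strict_mono_on {1..r} p"
    and "\<And>i. i \<in> {1..r} \<Longrightarrow> e i \<ge> 1"
    and "r \<ge> 4" and "e r \<ge> 2"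
    and "2 * totient (\<Prod>i=1..r - 1. p i) < (\<Prod>i=1..r - 1. p i)"
    and "min_cut_set (power_graph G) X"
  shows "(e r \<ge> 3 \<or> Omega r p e = {} \<longrightarrow>
            X = Zset G n r p r (e r) \<and>
            real (vertex_connectivity (power_graph G)) = beta n r p r (e r))
       \<and> (e r = 2 \<and> Omega r p e \<noteq> {} \<longrightarrow>
            (let b = Max (Omega r p e) in
              (X = Zset G n r p r (e r) \<or> X = Zset G n r p b (e b)) \<and>
              real (vertex_connectivity (power_graph G)) \<in> {beta n r p b (e b), beta n r p r (e r)}))"
proof -
  interpret G: cyclic_group_prime_powers G n r p e
    using assms
    by (simp add: cyclic_group_prime_powers_def cyclic_group_prime_powers_axioms_def prime_power_product_def)
  have r_in: "r \<in> {1..r}"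
    using assms(8) by simp
  have "{1..r} - {r} = {1..r - 1}"
    using assms(8) by auto
  then have "(\<Prod>k=1..r. p k) div p r = (\<Prod>k=1..r - 1. p k)"
    using G.prod_p_div[OF r_in] by simp
  then have density: "G.density r < 1 / 2"
    using G.totient_prod_p_div_less_iff[OF r_in] assms(10) by simp
  have "finite (verts (power_graph G))"
    using G.finite_G by (simp add: power_graph_def)
  then have conn: "vertex_connectivity (power_graph G) = card X"
    by (rule vertex_connectivity_eq_card_min_cut_set[OF assms(11)])
  have card: "real (card (Zset G n r p i (e i))) = beta n r p i (e i)" if "i \<in> {1..r}" for i
    using G.card_Zset[OF that] G.beta_eq_cut_ratio[OF that] assms(7)[OF that] by simp
  show ?thesis
    using G.min_cut_set_classification[OF assms(8,9) density assms(11)]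
  proof cases
    case 1
    moreover have "real (vertex_connectivity (power_graph G)) = beta n r p r (e r)"
      using 1 conn card[OF r_in] by simp
    ultimately show ?thesis
      unfolding Let_def by blast
  next
    case (2 b)
    moreover have "real (vertex_connectivity (power_graph G)) = beta n r p b (e b)"
      using 2 conn card[OF 2(4)] by simp
    ultimately show ?thesis
      unfolding Let_def by auto
  qed
qed

end
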